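(* Consider the balanced DHV network, with $m_1+m_4=m_2+m_5=m_3+m_6=1$. There exists $\bar\alpha\in(0,1)$ (depending on the mean service times $m_1,\dots,m_6$) such that if $\alpha_1>\bar\alpha$ and (i) the nominal-load conditions are satisfied: $\rho_1=\rho_2=\rho_3<1$ (equivalently, $\alpha_1<1$), (ii) $m_2+m_4+m_6<2$, then the network satisfies state-space collapse under any queue-ratio policy, i.e., under every ratio matrix $\Delta$.
   Context: DHV network: $J=3$ stations, $K=6$ classes. Jobs arrive exogenously only to class $1$, at rate $\alpha_1$, and follow the deterministic route $1\to2\to3\to4\to5\to6\to$ exit (so $P_{k,k+1}=1$ for $k=1,\dots,5$, all other $P_{kl}=0$, $\alpha=(\alpha_1,0,\dots,0)'$). Station 1 serves classes $1,4$; station 2 serves $2,5$; station 3 serves $3,6$; $s(k)$ is the station serving class $k$. $m_k>0$ is the mean service time of class $k$, $M=\mathrm{diag}(m_1,\dots,m_6)$, $C$ is the $3\times6$ matrix with $C_{jk}=1$ if $s(k)=j$ and $0$ otherwise, $\rho=CM(I-P')^{-1}\alpha$, $e$ is the all-ones vector. The network is balanced if all $\rho_j$ are equal; time is normalized so that the common value of $m_1+m_4$, $m_2+m_5$, $m_3+m_6$ is $1$. A ratio matrix (encoding a queue-ratio policy) is a nonnegative $K\times J$ matrix $\Delta$ with $\Delta_{kj}=0$ if $s(k)\ne j$, and $CM\Delta=I$. Fluid model under $\Delta$. A solution consists of Lipschitz functions on $[0,\infty)$ satisfying: $\bar Z(t)=\bar Z(0)+\alpha t-(I-P')M^{-1}\bar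 T(t)\ge 0$; $\bar W(t)=CM\bar Z(t)$; $\bar\epsilon(t)=\bar Z(t)-\Delta\bar W(t)$; $\bar T(0)=0$ and $\bar T$ is nondecreasing; $\bar Y(t)=et-C\bar T(t)$ is nondecreasing; $\int_0^\infty \bar W_j(s)\,d\bar Y_j(s)=0$ for each $j$; and for each class $k$ and each time $t$ of differentiability, $\bar\epsilon_k^+(t)\bigl(1-\dot{\bar T}{}_k^+(t)\bigr)=0$, where $\bar\epsilon_k^+(t)=\sum_{i\le k:\,s(i)=s(k),\,\bar\epsilon_i(t)>0}\bar\epsilon_i(t)$ and $\dot{\bar T}{}_k^+(t)=\sum_{i\le k:\,s(i)=s(k),\,\bar\epsilon_i(t)>0}\dot{\bar T}_i(t)$. State-space collapse under $\Delta$: for every fluid solution there is $t_0\ge0$ (possibly depending on $\bar Z(0)$) with $\bar Z(t)=\Delta\bar W(t)$ for all $t\ge t_0$. *)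

theory Defs
  imports "HOL-Analysis.Analysis"
begin

section \<open>Multiclass queueing networks\<close>

text \<open>
  A network is given by its routing matrix \<open>P\<close>, the station \<open>s k\<close> serving class \<open>k\<close>, the mean
  service times \<open>m\<close> and the exogenous arrival rates \<open>\<alpha>\<close>.  Classes are indexed by \<open>'k\<close> (whose order
  is the numbering of the classes), stations by \<open>'j\<close>.
\<close>

definition service_matrix :: "real ^ 'k \<Rightarrow> real ^ 'k ^ 'k"
  where "service_matrix m = (\<chi> k l. if k = l then m $ k else 0)"

definition constituency_matrix :: "('k \<Rightarrow> 'j) \<Rightarrow> real ^ 'k ^ 'j"
  where "constituency_matrix s = (\<chi> j k. if s k = j then 1 else 0)"

definition traffic_intensity ::
    "real ^ 'k ^ 'k \<Rightarrow> ('k::finite \<Rightarrow> 'j::finite) \<Rightarrow> real ^ 'k \<Rightarrow> real ^ 'k \<Rightarrow> real ^ 'j"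
  where "traffic_intensity P s m \<alpha> =
    (constituency_matrix s ** service_matrix m ** matrix_inv (mat 1 - transpose P)) *v \<alpha>"

definition ratio_matrix ::
    "('k::finite \<Rightarrow> 'j::finite) \<Rightarrow> real ^ 'k \<Rightarrow> real ^ 'j ^ 'k \<Rightarrow> bool"
  where "ratio_matrix s m \<Delta> \<longleftrightarrow>
    (\<forall>k j. 0 \<le> \<Delta> $ k $ j) \<and>
    (\<forall>k j. s k \<noteq> j \<longrightarrow> \<Delta> $ k $ j = 0) \<and>
    constituency_matrix s ** service_matrix m ** \<Delta> = mat 1"


section \<open>The fluid model under a ratio matrix\<close>

text \<open>
  The notation \<open>real ^ 'k\<close> insists on the sort \<open>finite\<close> for \<open>'k\<close>, so it cannot be combined
  with the sort \<open>{finite, linorder}\<close>.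
\<close>

type_synonym 'k rvector = "(real, 'k) vec"
type_synonym ('k, 'j) rmatrix = "((real, 'j) vec, 'k) vec"

definition excess_classes ::
    "('k::{finite,linorder} \<Rightarrow> 'j) \<Rightarrow> 'k rvector \<Rightarrow> 'k \<Rightarrow> 'k set"
  where "excess_classes s e k = {i. i \<le> k \<and> s i = s k \<and> 0 < e $ i}"

text \<open>
  All functions matter on \<open>[0, \<infinity>)\<close> only.  The Stieltjes integral of \<open>W\<^sub>j\<close> against \<open>Y\<^sub>j\<close> is taken with
  respect to the Lebesgue-Stieltjes measure of \<open>Y\<^sub>j\<close>, extended to the left of \<open>0\<close> by its value
  at \<open>0\<close>.  The nonnegative integral is used because the Bochner integral of a non-integrable
  function is \<open>0\<close> by convention; nothing is lost, since \<open>W\<^sub>j \<ge> 0\<close>.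
\<close>

definition fluid_solution ::
    "('k, 'k) rmatrix \<Rightarrow> ('k::{finite,linorder} \<Rightarrow> 'j::finite) \<Rightarrow> 'k rvector \<Rightarrow> 'k rvector \<Rightarrow>
     ('k, 'j) rmatrix \<Rightarrow> (real \<Rightarrow> 'k rvector) \<Rightarrow> (real \<Rightarrow> 'j rvector) \<Rightarrow> (real \<Rightarrow> 'k rvector) \<Rightarrow>
     (real \<Rightarrow> 'k rvector) \<Rightarrow> (real \<Rightarrow> 'j rvector) \<Rightarrow> bool"
  where "fluid_solution P s m \<alpha> \<Delta> Z W \<epsilon> T Y \<longleftrightarrow>
    (\<exists>L. L-lipschitz_on {0..} Z) \<and> (\<exists>L. L-lipschitz_on {0..} W) \<and>
    (\<exists>L. L-lipschitz_on {0..} \<epsilon>) \<and> (\<exists>L. L-lipschitz_on {0..} T) \<and>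
    (\<exists>L. L-lipschitz_on {0..} Y) \<and>
    (\<forall>t\<ge>0. Z t = Z 0 + t *\<^sub>R \<alpha> - ((mat 1 - transpose P) ** matrix_inv (service_matrix m)) *v T t) \<and>
    (\<forall>t\<ge>0. \<forall>k. 0 \<le> Z t $ k) \<and>
    (\<forall>t\<ge>0. W t = (constituency_matrix s ** service_matrix m) *v Z t) \<and>
    (\<forall>t\<ge>0. \<epsilon> t = Z t - \<Delta> *v W t) \<and>
    T 0 = 0 \<and>
    (\<forall>k. mono_on {0..} (\<lambda>t. T t $ k)) \<and>
    (\<forall>t\<ge>0. Y t = t *\<^sub>R (\<chi> j. 1) - constituency_matrix s *v T t) \<and>
    (\<forall>j. mono_on {0..} (\<lambda>t. Y t $ j)) \<and>
    (\<forall>j. (\<integral>\<^sup>+ t\<in>{0..}. ennreal (W t $ j) \<partial>interval_measure (\<lambda>t. Y (max 0 t) $ j)) = 0) \<and>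
    (\<forall>t>0. \<forall>T'. (T has_vector_derivative T') (at t) \<longrightarrow>
      (\<forall>k. (\<Sum>i\<in>excess_classes s (\<epsilon> t) k. \<epsilon> t $ i) *
           (1 - (\<Sum>i\<in>excess_classes s (\<epsilon> t) k. T' $ i)) = 0))"

definition state_space_collapse ::
    "('k, 'k) rmatrix \<Rightarrow> ('k::{finite,linorder} \<Rightarrow> 'j::finite) \<Rightarrow> 'k rvector \<Rightarrow> 'k rvector \<Rightarrow>
     ('k, 'j) rmatrix \<Rightarrow> bool"
  where "state_space_collapse P s m \<alpha> \<Delta> \<longleftrightarrow>
    (\<forall>Z W \<epsilon> T Y. fluid_solution P s m \<alpha> \<Delta> Z W \<epsilon> T Y \<longrightarrow>
      (\<exists>t\<^sub>0\<ge>0. \<forall>t\<ge>t\<^sub>0. Z t = \<Delta> *v W t))"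


section \<open>The DHV network\<close>

text \<open>
  The numeral type \<open>6\<close> is not used for the classes, since there \<open>6 = 0\<close> is the least element.
  For the stations, the numeral type \<open>3\<close> is harmless because their order plays no role.
\<close>

datatype dhv_class = K1 | K2 | K3 | K4 | K5 | K6

fun class_number :: "dhv_class \<Rightarrow> nat" where
  "class_number K1 = 1"
| "class_number K2 = 2"
| "class_number K3 = 3"
| "class_number K4 = 4"
| "class_number K5 = 5"
| "class_number K6 = 6"

lemma UNIV_dhv_class: "UNIV = {K1, K2, K3, K4, K5, K6}"
proof -
  have "x \<in> {K1, K2, K3, K4, K5, K6}" for x by (cases x) simp_all
  then show ?thesis by blast
qed

lemma class_number_inject: "class_number k = class_number l \<longleftrightarrow> k = l"
  by (cases k; cases l) simp_all

instance dhv_class :: finite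
  by standard (simp add: UNIV_dhv_class)

instantiation dhv_class :: linorder
begin

definition "k \<le> l \<longleftrightarrow> class_number k \<le> class_number l"
definition "k < l \<longleftrightarrow> class_number k < class_number l"

instance
  by standard (auto simp: less_eq_dhv_class_def less_dhv_class_def class_number_inject[symmetric])

end

fun dhv_station :: "dhv_class \<Rightarrow> 3" where
  "dhv_station K1 = 1"
| "dhv_station K2 = 2"
| "dhv_station K3 = 3"
| "dhv_station K4 = 1"
| "dhv_station K5 = 2"
| "dhv_station K6 = 3"

definition dhv_routing :: "real ^ dhv_class ^ dhv_class"
  where "dhv_routing = (\<chi> k l. if class_number l = class_number k + 1 then 1 else 0)"

definition dhv_arrivals :: "real \<Rightarrow> real ^ dhv_class"
  where "dhv_arrivals \<alpha>\<^sub>1 = (\<chi> k. if k = K1 then \<alpha>\<^sub>1 else 0)"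

abbreviation dhv_traffic_intensity :: "real ^ dhv_class \<Rightarrow> real \<Rightarrow> real ^ 3"
  where "dhv_traffic_intensity m \<alpha>\<^sub>1 \<equiv>
    traffic_intensity dhv_routing dhv_station m (dhv_arrivals \<alpha>\<^sub>1)"

end

theory Submission
  imports Defs
begin

text \<open>
  Let \<open>p\<close> be the share of a station's workload that \<open>\<Delta>\<close> assigns to its earlier class, let \<open>\<mu>\<close>, \<open>\<nu>\<close> be
  the service times and \<open>z\<close>, \<open>w\<close> the queues of its earlier and later class, and put
  \<open>x = (1 - p) \<mu> z - p \<nu> w\<close>.  Collapse means that the three imbalances \<open>x1\<close>, \<open>x2\<close>, \<open>x3\<close> vanish.
  The sign of \<open>x\<close> tells which class is served; at almost every time with \<open>x = 0\<close> also \<open>x' = 0\<close>,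
  which determines the service rates unless the station is empty.

  Always \<open>x1 \<le> 0\<close> from some time on.  If \<open>m2 < m1\<close> or \<open>m6 < m5\<close>, the positive and negative parts of
  the imbalances then die out one after the other.  In the remaining case the only possible growth is
  a cycle in which the negative part of \<open>x3\<close> feeds the positive part of \<open>x2\<close>, which feeds the negative
  part of \<open>x1\<close>, which feeds the negative part of \<open>x3\<close>.  The weights \<open>1/m1\<close>, \<open>1/m3\<close>, \<open>1/m5\<close>
  balance the three gains exactly when \<open>m2 + m4 + m6 = 2\<close>, so below \<open>2\<close> they give a piecewise linear
  Lyapunov function with strictly negative drift.  Values \<open>\<alpha>\<^sub>1 < 1\<close> perturb the drifts by
  \<open>O(1 - \<alpha>\<^sub>1)\<close>, uniformly in \<open>\<Delta>\<close> because each part of \<open>x\<close> is divided by \<open>1 - p\<close> or \<open>p\<close>.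
\<close>

section \<open>Almost everywhere differentiability of Lipschitz functions\<close>

text \<open>The measures induced by \<open>f\<close> and \<open>x - f x\<close> add up to Lebesgue measure.\<close>

lemma interval_measure_le_lborel:
  fixes f :: "real \<Rightarrow> real"
  assumes f: "mono f" and g: "mono (\<lambda>x. x - f x)" and S: "S \<in> sets borel"
  shows "emeasure (interval_measure f) S \<le> emeasure lborel S"
proof -
  define g where "g = (\<lambda>x. x - f x)"
  have lip: "\<bar>f x - f y\<bar> \<le> \<bar>x - y\<bar>" for x y
    using monoD[OF f, of x y] monoD[OF f, of y x] monoD[OF g, of x y] monoD[OF g, of y x]
    by (cases "x \<le> y") auto
  have "1-lipschitz_on UNIV f"
    by (rule lipschitz_onI) (use lip in \<open>auto simp: dist_real_def\<close>)
  then have cf: "continuous_on UNIV f" by (rule lipschitz_on_continuous_on)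
  then have cg: "continuous_on UNIV g" unfolding g_def by (intro continuous_intros)
  define F where "F = interval_measure f"
  define G where "G = interval_measure g"
  define M where "M = measure_of UNIV (sets borel) (\<lambda>A. emeasure F A + emeasure G A)"
  have sets: "sets F = sets borel" "sets G = sets borel" by (simp_all add: F_def G_def)
  have M: "emeasure M A = emeasure F A + emeasure G A" if "A \<in> sets borel" for A
  proof (rule emeasure_measure_of[OF M_def])
    show "countably_additive (sets M) (\<lambda>A. emeasure F A + emeasure G A)"
    proof (rule countably_additiveI)
      fix A :: "nat \<Rightarrow> real set"
      assume A: "range A \<subseteq> sets M" "disjoint_family A"
      then have "range A \<subseteq> sets borel"
        using sets.sigma_sets_eq[of "borel :: real measure"] by (simp add: M_def)
      with A(2) sets show "(\<Sum>i. emeasure F (A i) + emeasure G (A i)) =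
          emeasure F (\<Union>(range A)) + emeasure G (\<Union>(range A))"
        by (simp add: suminf_add[symmetric] suminf_emeasure)
    qed
  qed (use that in \<open>auto simp: M_def positive_def sets.space_closed[of borel, simplified]\<close>)
  have "lborel = M"
  proof (rule lborel_eqI)
    fix l u :: real
    assume "\<And>b. b \<in> Basis \<Longrightarrow> l \<bullet> b \<le> u \<bullet> b"
    then have lu: "l \<le> u" by simp
    \<comment> \<open>The boxes that characterise Lebesgue measure are open intervals, whereas
      \<open>interval_measure\<close> is computed on half-open ones. By continuity the right end
      point carries no mass.\<close>
    have null: "emeasure (interval_measure h) {u} = 0"
      if "mono h" "continuous_on UNIV h" for h :: "real \<Rightarrow> real"
      using emeasure_interval_measure_Icc[of u u h] that by (simp add: monoD)
    have bx: "emeasure (interval_measure h) {l<..<u} = ennreal (h u - h l)"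
      if h: "mono h" "continuous_on UNIV h" for h :: "real \<Rightarrow> real"
    proof -
      have "isCont h a" for a using h(2) by (simp add: continuous_on_eq_continuous_at)
      then have "continuous (at_right a) h" for a by (rule continuous_at_imp_continuous_at_within)
      then have "emeasure (interval_measure h) {l<..u} = ennreal (h u - h l)"
        by (intro emeasure_interval_measure_Ioc lu) (use h in \<open>auto simp: monoD\<close>)
      moreover have "emeasure (interval_measure h) ({l<..u} - {u}) = emeasure (interval_measure h) {l<..u}"
        using null[OF h] by (intro emeasure_Diff_null_set) (auto simp: null_sets_def)
      moreover have "{l<..u} - {u} = {l<..<u}" by auto
      ultimately show ?thesis by simp
    qed
    have "emeasure M (box l u) = ennreal (f u - f l) + ennreal (g u - g l)"
      using bx[OF f cf] bx[OF _ cg] g by (simp add: M F_def G_def box_real g_def)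
    also have "\<dots> = ennreal (u - l)"
      using monoD[OF f lu] monoD[OF g lu] by (simp add: ennreal_plus[symmetric] g_def del: ennreal_plus)
    finally show "emeasure M (box l u) = (\<Prod>b\<in>Basis. (u - l) \<bullet> b)" by simp
  qed (use sets.sigma_sets_eq[of "borel :: real measure"] in \<open>simp add: M_def\<close>)
  then show ?thesis using M[OF S] by (simp add: F_def)
qed

section \<open>Comparison of measures by Vitali coverings\<close>

text \<open>Inside an open set slightly larger than \<open>E\<close>, Vitali's theorem selects
  countably many disjoint balls on which the inequality holds and which cover \<open>E\<close> up to
  a Lebesgue null set. The bound \<open>C\<close> makes the null set invisible to \<open>N1\<close>
  and the overshoot small for \<open>N2\<close>.\<close>

lemma emeasure_le_by_fine_intervals:
  fixes N1 N2 :: "real measure"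
  assumes sets1: "sets N1 = sets borel" and sets2: "sets N2 = sets borel"
    and N1: "\<And>S. S \<in> sets borel \<Longrightarrow> emeasure N1 S \<le> ennreal C * emeasure lborel S"
    and N2: "\<And>S. S \<in> sets borel \<Longrightarrow> emeasure N2 S \<le> ennreal C * emeasure lborel S"
    and E: "E \<in> sets borel"
    and fine: "\<And>x d. x \<in> E \<Longrightarrow> 0 < d \<Longrightarrow>
      \<exists>c r. 0 < r \<and> r < d \<and> x \<in> cball c r \<and> emeasure N1 (cball c r) \<le> emeasure N2 (cball c r)"
  shows "emeasure N1 E \<le> emeasure N2 E"
proof (rule ennreal_le_epsilon)
  fix e :: real
  assume "0 < e"
  define e' where "e' = e / (1 + \<bar>C\<bar>)"
  have "0 < e'" using \<open>0 < e\<close> by (simp add: e'_def)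
  have E': "E \<in> sets lebesgue" using E by simp
  obtain U where U: "open U" "E \<subseteq> U" "emeasure lebesgue (U - E) < ennreal e'"
    using sets_lebesgue_outer_open[OF E' \<open>0 < e'\<close>] by blast
  have mU: "U - E \<in> sets borel" using U(1) E by auto
  define K where "K = {i::real \<times> real. 0 < snd i \<and> cball (fst i) (snd i) \<subseteq> U \<and>
      emeasure N1 (cball (fst i) (snd i)) \<le> emeasure N2 (cball (fst i) (snd i))}"
  obtain I where I: "countable I" "I \<subseteq> K"
    "pairwise (\<lambda>i j. disjnt (cball (fst i) (snd i)) (cball (fst j) (snd j))) I"
    "negligible (E - (\<Union>i\<in>I. cball (fst i) (snd i)))"
  proof (rule Vitali_covering_theorem_cballs[of K snd E fst])
    show "0 < snd i" if "i \<in> K" for i using that by (simp add: K_def)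
    fix x d :: real
    assume x: "x \<in> E" "0 < d"
    then obtain k where k: "0 < k" "ball x k \<subseteq> U"
      using U openE by blast
    \<comment> \<open>A ball of radius \<open>r\<close> containing \<open>x\<close> lies within
      distance \<open>2 * r\<close> of \<open>x\<close>, so a radius below \<open>k / 2\<close>
      keeps it inside \<open>U\<close>.\<close>
    then obtain c r where cr: "0 < r" "r < min d (k / 2)" "x \<in> cball c r"
      "emeasure N1 (cball c r) \<le> emeasure N2 (cball c r)"
      using fine[OF x(1), of "min d (k / 2)"] x(2) by auto
    have "cball c r \<subseteq> ball x k"
    proof
      fix y assume "y \<in> cball c r"
      then have "dist x y \<le> r + r"
        using cr(3) dist_triangle2[of x y c] by (simp add: dist_commute)
      then show "y \<in> ball x k" using cr(2) by simp
    qed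
    then show "\<exists>i. i \<in> K \<and> x \<in> cball (fst i) (snd i) \<and> snd i < d"
      using cr k(2) by (intro exI[of _ "(c, r)"]) (auto simp: K_def)
  qed
  let ?B = "\<lambda>i::real \<times> real. cball (fst i) (snd i)"
  let ?U = "\<Union>i\<in>I. ?B i"
  have dis: "disjoint_family_on ?B I"
    using I(3) by (auto simp: disjoint_family_on_def pairwise_def disjnt_def)
  have mB: "?U \<in> sets borel" using I(1) by (intro sets.countable_UN') auto
  have "E - ?U \<in> null_sets lebesgue" using I(4) by (simp add: negligible_iff_null_sets)
  then have "emeasure lborel (E - ?U) = 0"
    using mB E by (simp add: null_sets_completion_iff null_setsD1)
  then have n1: "emeasure N1 (E - ?U) = 0"
    using N1[of "E - ?U"] mB E by simp
  have "emeasure N1 E \<le> emeasure N1 (?U \<union> (E - ?U))"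
    using mB E sets1 by (intro emeasure_mono) auto
  also have "\<dots> \<le> emeasure N1 ?U + emeasure N1 (E - ?U)"
    using mB E sets1 by (intro emeasure_subadditive) auto
  also have "\<dots> = emeasure N1 ?U" using n1 by simp
  also have "\<dots> = (\<integral>\<^sup>+i. emeasure N1 (?B i) \<partial>count_space I)"
    using I(1) dis sets1 by (intro emeasure_UN_countable) auto
  also have "\<dots> \<le> (\<integral>\<^sup>+i. emeasure N2 (?B i) \<partial>count_space I)"
    using I(2) by (intro nn_integral_mono) (auto simp: K_def)
  also have "\<dots> = emeasure N2 ?U"
    using I(1) dis sets2 by (intro emeasure_UN_countable[symmetric]) auto
  also have "\<dots> \<le> emeasure N2 (E \<union> (U - E))"
    using I(2) U(1) E sets2 by (intro emeasure_mono) (auto simp: K_def)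
  also have "\<dots> \<le> emeasure N2 E + emeasure N2 (U - E)"
    using mU E sets2 by (intro emeasure_subadditive) auto
  also have "emeasure N2 (U - E) \<le> ennreal C * ennreal e'"
  proof -
    have "emeasure lborel (U - E) \<le> ennreal e'" using U(3) mU by simp
    then show ?thesis using N2[OF mU] by (meson mult_left_mono order_trans zero_le)
  qed
  also have "ennreal C * ennreal e' \<le> ennreal e"
  proof (cases "0 \<le> C")
    case True
    then have "C * e' \<le> e" using \<open>0 < e\<close> by (simp add: e'_def field_simps)
    then show ?thesis using True \<open>0 < e'\<close> by (simp add: ennreal_mult[symmetric] ennreal_leI)
  next
    case False
    then show ?thesis by (simp add: ennreal_neg)
  qed
  finally show "emeasure N1 E \<le> emeasure N2 E + ennreal e" by (simp add: add_left_mono)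
qed

section \<open>Difference quotients of monotone functions with slope at most one\<close>

lemma frequently_at_0_iff:
  "(\<exists>\<^sub>F h in at (0::real). P h) \<longleftrightarrow> (\<forall>d>0. \<exists>h. h \<noteq> 0 \<and> \<bar>h\<bar> < d \<and> P h)"
  unfolding frequently_def eventually_at by (auto simp: dist_real_def)

text \<open>For fixed \<open>h\<close> the quotient is continuous in \<open>x\<close>. An arbitrary
  union over small \<open>h\<close> is therefore open, and the bounds on \<open>h\<close> can be
  restricted to a countable sequence tending to 0.\<close>

lemma borel_frequently_quotient_less:
  fixes f :: "real \<Rightarrow> real"
  assumes "continuous_on UNIV f"
  shows "{x. \<exists>\<^sub>F h in at 0. (f (x + h) - f x) / h < r} \<in> sets borel"
proof -
  have "{x. \<exists>\<^sub>F h in at 0. (f (x + h) - f x) / h < r} =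
      (\<Inter>n::nat. \<Union>h\<in>{h. h \<noteq> 0 \<and> \<bar>h\<bar> < inverse (Suc n)}. {x. (f (x + h) - f x) / h < r})"
    (is "?A = ?B")
  proof (intro set_eqI iffI)
    fix x assume "x \<in> ?A"
    then show "x \<in> ?B" unfolding frequently_at_0_iff by simp
  next
    fix x assume B: "x \<in> ?B"
    have "\<exists>h. h \<noteq> 0 \<and> \<bar>h\<bar> < d \<and> (f (x + h) - f x) / h < r" if "0 < d" for d
    proof -
      obtain n where n: "inverse (real (Suc n)) < d" using reals_Archimedean[OF \<open>0 < d\<close>] by auto
      obtain h where "h \<noteq> 0" "\<bar>h\<bar> < inverse (real (Suc n))" "(f (x + h) - f x) / h < r"
        using B by blast
      with n show ?thesis by (intro exI[of _ h]) linarith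
    qed
    then show "x \<in> ?A" unfolding frequently_at_0_iff by simp
  qed
  moreover have "open {x. (f (x + h) - f x) / h < r}" if "h \<noteq> 0" for h
    using that by (intro open_Collect_less continuous_intros continuous_on_compose2[OF assms]) auto
  then have "open (\<Union>h\<in>{h. h \<noteq> 0 \<and> \<bar>h\<bar> < inverse (Suc n)}. {x. (f (x + h) - f x) / h < r})" for n
    by blast
  ultimately show ?thesis by (auto intro: borel_open)
qed

text \<open>Up to adding a linear function and rescaling, every Lipschitz function is of this kind.\<close>

locale unit_growth =
  fixes f :: "real \<Rightarrow> real"
  assumes mono: "mono f" and mono_diff: "mono (\<lambda>x. x - f x)"
begin

lemma quotient_bounds: "h \<noteq> 0 \<Longrightarrow> 0 \<le> (f (x + h) - f x) / h \<and> (f (x + h) - f x) / h \<le> 1"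
  using monoD[OF mono, of x "x + h"] monoD[OF mono, of "x + h" x]
    monoD[OF mono_diff, of x "x + h"] monoD[OF mono_diff, of "x + h" x]
  by (cases "0 < h") (auto simp: field_simps)

lemma continuous: "continuous_on UNIV f"
proof (rule lipschitz_on_continuous_on)
  have "\<bar>f x - f y\<bar> \<le> \<bar>x - y\<bar>" for x y
    using monoD[OF mono, of x y] monoD[OF mono, of y x] monoD[OF mono_diff, of x y] monoD[OF mono_diff, of y x]
    by (cases "x \<le> y") auto
  then show "1-lipschitz_on UNIV f" by (intro lipschitz_onI) (auto simp: dist_real_def)
qed

text \<open>The ball is the closed interval between \<open>x\<close> and \<open>x + h\<close>, for
  either sign of \<open>h\<close>. It is written as a ball to fit the covering lemma, which accepts
  \<open>x\<close> as an end point.\<close>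

lemma emeasure_quotient_interval:
  assumes "h \<noteq> 0"
  shows "emeasure (interval_measure f) (cball (x + h / 2) (\<bar>h\<bar> / 2)) = ennreal ((f (x + h) - f x) / h * \<bar>h\<bar>)"
    and "emeasure lborel (cball (x + h / 2) (\<bar>h\<bar> / 2)) = ennreal \<bar>h\<bar>"
    and "x \<in> cball (x + h / 2) (\<bar>h\<bar> / 2)"
proof -
  have eq: "cball (x + h / 2) (\<bar>h\<bar> / 2) = (if 0 < h then {x..x + h} else {x + h..x})"
    by (auto simp: cball_eq_atLeastAtMost field_simps abs_if)
  show "emeasure (interval_measure f) (cball (x + h / 2) (\<bar>h\<bar> / 2)) = ennreal ((f (x + h) - f x) / h * \<bar>h\<bar>)"
    using assms mono continuous unfolding eq by (auto simp: emeasure_interval_measure_Icc monoD)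
  show "emeasure lborel (cball (x + h / 2) (\<bar>h\<bar> / 2)) = ennreal \<bar>h\<bar>" "x \<in> cball (x + h / 2) (\<bar>h\<bar> / 2)"
    using assms unfolding eq by auto
qed

text \<open>A quotient below \<open>r\<close> says that the measure of the interval between
  \<open>x\<close> and \<open>x + h\<close> is at most \<open>r\<close> times its length. Such
  arbitrarily short intervals at each point of \<open>E\<close> feed the covering lemma.\<close>

lemma emeasure_le_of_quotients:
  assumes E: "E \<in> sets borel" and "0 \<le> r"
    and q: "\<And>x. x \<in> E \<Longrightarrow> \<exists>\<^sub>F h in at 0. (f (x + h) - f x) / h < r"
  shows "emeasure (interval_measure f) E \<le> ennreal r * emeasure lborel E"
proof -
  have "emeasure (interval_measure f) E \<le> emeasure (scale_measure r lborel) E"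
  proof (rule emeasure_le_by_fine_intervals[where C = "max 1 r"])
    fix S :: "real set" assume S: "S \<in> sets borel"
    have "emeasure (interval_measure f) S \<le> 1 * emeasure lborel S"
      using interval_measure_le_lborel[OF mono mono_diff S] by simp
    also have "\<dots> \<le> ennreal (max 1 r) * emeasure lborel S"
      by (intro mult_right_mono) (auto simp: ennreal_1[symmetric] simp del: ennreal_1 intro: ennreal_leI)
    finally show "emeasure (interval_measure f) S \<le> ennreal (max 1 r) * emeasure lborel S" .
    show "emeasure (scale_measure r lborel) S \<le> ennreal (max 1 r) * emeasure lborel S"
      by (auto intro!: mult_right_mono ennreal_leI)
  next
    fix x d :: real assume "x \<in> E" "0 < d"
    then obtain h where h: "h \<noteq> 0" "\<bar>h\<bar> < d" "(f (x + h) - f x) / h < r"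
      using q unfolding frequently_at_0_iff by blast
    then show "\<exists>c \<rho>. 0 < \<rho> \<and> \<rho> < d \<and> x \<in> cball c \<rho> \<and>
        emeasure (interval_measure f) (cball c \<rho>) \<le> emeasure (scale_measure r lborel) (cball c \<rho>)"
      using emeasure_quotient_interval[OF h(1), of x] quotient_bounds[OF h(1), of x]
      by (rule_tac exI[of _ "x + h / 2"], rule_tac exI[of _ "\<bar>h\<bar> / 2"])
        (auto simp: ennreal_mult[symmetric] simp del: mem_cball times_divide_eq_left
          intro!: ennreal_leI mult_right_mono)
  qed (use E in auto)
  then show ?thesis by simp
qed

lemma emeasure_ge_of_quotients:
  assumes E: "E \<in> sets borel" and "0 \<le> r"
    and q: "\<And>x. x \<in> E \<Longrightarrow> \<exists>\<^sub>F h in at 0. r < (f (x + h) - f x) / h"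
  shows "ennreal r * emeasure lborel E \<le> emeasure (interval_measure f) E"
proof -
  have "emeasure (scale_measure r lborel) E \<le> emeasure (interval_measure f) E"
  proof (rule emeasure_le_by_fine_intervals[where C = "max 1 r"])
    fix S :: "real set" assume S: "S \<in> sets borel"
    have "emeasure (interval_measure f) S \<le> 1 * emeasure lborel S"
      using interval_measure_le_lborel[OF mono mono_diff S] by simp
    also have "\<dots> \<le> ennreal (max 1 r) * emeasure lborel S"
      by (intro mult_right_mono) (auto simp: ennreal_1[symmetric] simp del: ennreal_1 intro: ennreal_leI)
    finally show "emeasure (interval_measure f) S \<le> ennreal (max 1 r) * emeasure lborel S" .
    show "emeasure (scale_measure r lborel) S \<le> ennreal (max 1 r) * emeasure lborel S"
      by (auto intro!: mult_right_mono ennreal_leI)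
  next
    fix x d :: real assume "x \<in> E" "0 < d"
    then obtain h where h: "h \<noteq> 0" "\<bar>h\<bar> < d" "r < (f (x + h) - f x) / h"
      using q unfolding frequently_at_0_iff by blast
    then show "\<exists>c \<rho>. 0 < \<rho> \<and> \<rho> < d \<and> x \<in> cball c \<rho> \<and>
        emeasure (scale_measure r lborel) (cball c \<rho>) \<le> emeasure (interval_measure f) (cball c \<rho>)"
      using emeasure_quotient_interval[OF h(1), of x] \<open>0 \<le> r\<close>
      by (rule_tac exI[of _ "x + h / 2"], rule_tac exI[of _ "\<bar>h\<bar> / 2"])
        (auto simp: ennreal_mult[symmetric] simp del: mem_cball times_divide_eq_left
          intro!: ennreal_leI mult_right_mono)
  qed (use E in auto)
  then show ?thesis by simp
qed

text \<open>On the set where both events occur, the two preceding comparisons give \<open>s\<close>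
  times Lebesgue measure at most \<open>r\<close> times Lebesgue measure, which forces measure
  0.\<close>

lemma AE_no_oscillation:
  assumes "r < s"
  shows "AE x in lborel. \<not> ((\<exists>\<^sub>F h in at 0. (f (x + h) - f x) / h < r) \<and>
                            (\<exists>\<^sub>F h in at 0. s < (f (x + h) - f x) / h))"
proof (cases "0 < r")
  case False
  have "\<not> (\<exists>\<^sub>F h in at 0. (f (x + h) - f x) / h < r)" for x
  proof -
    have "\<not> (f (x + h) - f x) / h < r" if "h \<noteq> 0" for h
      using quotient_bounds[OF that, of x] False by linarith
    then show ?thesis unfolding frequently_at_0_iff by (meson zero_less_one)
  qed
  then show ?thesis by simp
next
  case True
  define A where "A = {x. \<exists>\<^sub>F h in at 0. (f (x + h) - f x) / h < r}"
  define B where "B = {x. \<exists>\<^sub>F h in at 0. s < (f (x + h) - f x) / h}"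
  have A: "A \<in> sets borel" unfolding A_def by (rule borel_frequently_quotient_less[OF continuous])
  have "s < (f (x + h) - f x) / h \<longleftrightarrow> ((- f (x + h)) - (- f x)) / h < - s" for x h
  proof -
    have "((- f (x + h)) - (- f x)) / h = - ((f (x + h) - f x) / h)"
      by (simp add: divide_simps)
    then show ?thesis by simp
  qed
  then have "B = {x. \<exists>\<^sub>F h in at 0. ((- f (x + h)) - (- f x)) / h < - s}"
    unfolding B_def by simp
  then have B: "B \<in> sets borel"
    using borel_frequently_quotient_less[of "\<lambda>x. - f x" "- s"] continuous by (simp add: continuous_on_minus)
  \<comment> \<open>Truncation makes the Lebesgue measure finite, so that the inequality between its
    multiples by \<open>s\<close> and \<open>r\<close> can be solved in the reals.\<close>
  have null: "A \<inter> B \<inter> {- real n..real n} \<in> null_sets lborel" (is "?E \<in> _") for n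
  proof -
    have E: "?E \<in> sets borel" using A B by auto
    have "emeasure lborel ?E \<le> emeasure lborel {- real n..real n}" by (intro emeasure_mono) auto
    then have fin: "emeasure lborel ?E < \<infinity>" by (simp add: le_less_trans)
    have "ennreal s * emeasure lborel ?E \<le> ennreal r * emeasure lborel ?E"
      using emeasure_ge_of_quotients[OF E, of s] emeasure_le_of_quotients[OF E, of r] True assms
      by (auto simp: A_def B_def intro: order_trans)
    moreover obtain z where z: "emeasure lborel ?E = ennreal z" "0 \<le> z"
        using fin by (cases "emeasure lborel ?E") auto
    ultimately have "s * z \<le> r * z" using True assms by (simp add: ennreal_mult[symmetric])
    then have "(s - r) * z \<le> 0" by (simp add: algebra_simps)
    then have "z = 0" using z(2) assms by (simp add: mult_le_0_iff)
    then show ?thesis using E z by (simp add: null_sets_def)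
  qed
  have "x \<in> (\<Union>n. A \<inter> B \<inter> {- real n..real n})" if "x \<in> A \<inter> B" for x
  proof -
    obtain n where "\<bar>x\<bar> \<le> real n" using real_arch_simple by blast
    then have "x \<in> {- real n..real n}" by auto
    then show ?thesis using that by blast
  qed
  then have "A \<inter> B = (\<Union>n. A \<inter> B \<inter> {- real n..real n})" by auto
  moreover have "(\<Union>n. A \<inter> B \<inter> {- real n..real n}) \<in> null_sets lborel"
    using null by (intro null_sets_UN) auto
  ultimately have "A \<inter> B \<in> null_sets lborel" by simp
  then show ?thesis by (rule AE_I') (auto simp: A_def B_def)
qed

text \<open>A gap between lower and upper limit of the quotients contains two rationals, and there
  are only countably many pairs of them. So the limits agree almost everywhere, and they are finite
  because the quotients stay in \<open>[0, 1]\<close>.\<close>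

lemma AE_differentiable: "AE x in lborel. \<exists>D. (f has_real_derivative D) (at x)"
proof -
  have "AE x in lborel. \<forall>r\<in>\<rat>. \<forall>s\<in>\<rat>. r < s \<longrightarrow>
      \<not> ((\<exists>\<^sub>F h in at 0. (f (x + h) - f x) / h < r) \<and> (\<exists>\<^sub>F h in at 0. s < (f (x + h) - f x) / h))"
    using AE_no_oscillation by (simp add: AE_ball_countable countable_rat)
  then show ?thesis
  proof (rule AE_mp, intro AE_I2 impI)
    fix x
    assume osc: "\<forall>r\<in>\<rat>. \<forall>s\<in>\<rat>. r < s \<longrightarrow>
      \<not> ((\<exists>\<^sub>F h in at 0. (f (x + h) - f x) / h < r) \<and> (\<exists>\<^sub>F h in at 0. s < (f (x + h) - f x) / h))"
    define q where "q = (\<lambda>h. ereal ((f (x + h) - f x) / h))"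
    have nt: "\<not> trivial_limit (at (0::real))" by simp
    have ev: "\<forall>\<^sub>F h in at 0. 0 \<le> q h \<and> q h \<le> 1"
      unfolding q_def using quotient_bounds[of _ x] by (auto simp: eventually_at intro!: exI[of _ 1])
    have "Limsup (at 0) q \<le> Liminf (at 0) q"
    proof (rule ccontr)
      assume "\<not> ?thesis"
      then have lt: "Liminf (at 0) q < Limsup (at 0) q" by simp
      obtain r where r: "Liminf (at 0) q < ereal (real_of_rat r)" "ereal (real_of_rat r) < Limsup (at 0) q"
        using ereal_dense3[OF lt] by blast
      obtain s where s: "ereal (real_of_rat r) < ereal (real_of_rat s)" "ereal (real_of_rat s) < Limsup (at 0) q"
        using ereal_dense3[OF r(2)] by blast
      have "\<exists>\<^sub>F h in at 0. q h < ereal (real_of_rat r)"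
      proof (rule ccontr)
        assume "\<not> ?thesis"
        then have "\<forall>\<^sub>F h in at 0. ereal (real_of_rat r) \<le> q h" by (simp add: not_frequently not_less)
        then have "ereal (real_of_rat r) \<le> Liminf (at 0) q" by (rule Liminf_bounded)
        with r(1) show False by simp
      qed
      moreover have "\<exists>\<^sub>F h in at 0. ereal (real_of_rat s) < q h"
      proof (rule ccontr)
        assume "\<not> ?thesis"
        then have "\<forall>\<^sub>F h in at 0. q h \<le> ereal (real_of_rat s)" by (simp add: not_frequently not_less)
        then have "Limsup (at 0) q \<le> ereal (real_of_rat s)" by (rule Limsup_bounded)
        with s(2) show False by simp
      qed
      ultimately show False using osc s(1) unfolding q_def by (auto simp: Rats_def)
    qed
    then have eq: "Liminf (at 0) q = Limsup (at 0) q" using Liminf_le_Limsup[OF nt, of q] by simp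
    have "0 \<le> Liminf (at 0) q" "Limsup (at 0) q \<le> 1"
      using ev by (auto intro!: Liminf_bounded Limsup_bounded elim: eventually_mono)
    then obtain D where D: "Limsup (at 0) q = ereal D"
      unfolding eq by (cases "Limsup (at 0) q") auto
    have "(q \<longlongrightarrow> ereal D) (at 0)" using Liminf_eq_Limsup[OF nt] D eq by metis
    then have "((\<lambda>h. (f (x + h) - f x) / h) \<longlongrightarrow> D) (at 0)" by (simp add: q_def)
    then show "\<exists>D. (f has_real_derivative D) (at x)" unfolding DERIV_def by blast
  qed
qed

text \<open>The increment is the Stieltjes measure of \<open>{a..b}\<close>. Exceptional points form
  a Lebesgue null set, hence a null set for this measure, and at all others the quotients come below
  any \<open>s\<close> greater than \<open>r\<close>.\<close>

lemma increment_le: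
  assumes ab: "a \<le> b" and "0 \<le> r"
    and ae: "AE x in lborel. a < x \<longrightarrow> x < b \<longrightarrow> (\<forall>D. (f has_real_derivative D) (at x) \<longrightarrow> D \<le> r)"
  shows "f b - f a \<le> r * (b - a)"
proof (rule field_le_epsilon)
  fix e :: real assume "0 < e"
  \<comment> \<open>A strict margin above \<open>r\<close> is needed to pass from the derivative to
    the quotients. The summand 1 in the denominator covers \<open>a = b\<close> and keeps the total
    error at most \<open>e\<close>.\<close>
  define s where "s = r + e / (1 + (b - a))"
  have s: "r < s" using ab \<open>0 < e\<close> by (simp add: s_def)
  have "AE x in lborel. a < x \<longrightarrow> x < b \<longrightarrow> (\<exists>\<^sub>F h in at 0. (f (x + h) - f x) / h < s)"
    using ae AE_differentiable
  proof eventually_elim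
    case (elim x)
    show ?case
    proof (intro impI)
      assume "a < x" "x < b"
      with elim obtain D where D: "(f has_real_derivative D) (at x)" "D \<le> r" by blast
      then have "((\<lambda>h. (f (x + h) - f x) / h) \<longlongrightarrow> D) (at 0)" unfolding DERIV_def by blast
      then have "\<forall>\<^sub>F h in at 0. (f (x + h) - f x) / h < s" by (rule order_tendstoD(2)) (use D(2) s in simp)
      then show "\<exists>\<^sub>F h in at 0. (f (x + h) - f x) / h < s" by (intro eventually_frequently) auto
    qed
  qed
  then obtain N where N: "N \<in> null_sets lborel"
    "{x \<in> space lborel. \<not> (a < x \<longrightarrow> x < b \<longrightarrow> (\<exists>\<^sub>F h in at 0. (f (x + h) - f x) / h < s))} \<subseteq> N"
    unfolding eventually_ae_filter by blast
  \<comment> \<open>The end points are discarded as well, since the derivative bound concerns the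
    open interval only.\<close>
  define N' where "N' = {a, b} \<union> N"
  have N': "N' \<in> null_sets lborel"
    using null_sets.Un[OF finite_imp_null_set_lborel[of "{a, b}"] N(1)] by (simp add: N'_def)
  let ?E = "{a..b} - N'"
  have E: "?E \<in> sets borel" using N' by (auto simp: null_sets_def)
  have NB: "N' \<in> sets borel" using N' by (auto simp: null_sets_def)
  have "emeasure (interval_measure f) N' \<le> emeasure lborel N'"
    by (rule interval_measure_le_lborel[OF mono mono_diff NB])
  then have N0: "emeasure (interval_measure f) N' = 0" using N' by (simp add: null_sets_def)
  have "ennreal (f b - f a) = emeasure (interval_measure f) {a..b}"
    using emeasure_interval_measure_Icc[OF ab _ continuous] mono by (simp add: monoD)
  also have "\<dots> \<le> emeasure (interval_measure f) (?E \<union> N')"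
    using E NB by (intro emeasure_mono) auto
  also have "\<dots> \<le> emeasure (interval_measure f) ?E + emeasure (interval_measure f) N'"
    using E NB by (intro emeasure_subadditive) auto
  also have "\<dots> = emeasure (interval_measure f) ?E" using N0 by simp
  also have "\<dots> \<le> ennreal s * emeasure lborel ?E"
  proof (rule emeasure_le_of_quotients[OF E])
    fix x assume "x \<in> ?E"
    then have "a < x" "x < b" "x \<notin> N" by (auto simp: N'_def)
    then show "\<exists>\<^sub>F h in at 0. (f (x + h) - f x) / h < s" using N(2) by auto
  qed (use s \<open>0 \<le> r\<close> in simp)
  also have "\<dots> \<le> ennreal s * emeasure lborel {a..b}"
    by (intro mult_left_mono emeasure_mono) auto
  also have "\<dots> = ennreal (s * (b - a))"
    using ab s \<open>0 \<le> r\<close> by (simp add: ennreal_mult)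
  finally have "f b - f a \<le> s * (b - a)"
    using ab s \<open>0 \<le> r\<close> by simp
  also have "\<dots> \<le> r * (b - a) + e"
    using ab \<open>0 < e\<close> by (simp add: s_def field_simps)
  finally show "f b - f a \<le> r * (b - a) + e" .
qed

end

section \<open>Transfer to Lipschitz functions\<close>

text \<open>Since \<open>f / K\<close> has slopes in \<open>[-1, 1]\<close>, adding the identity and
  halving moves them to \<open>[0, 1]\<close>.\<close>

lemma unit_growth_of_lipschitz:
  fixes f :: "real \<Rightarrow> real"
  assumes "L-lipschitz_on UNIV f" and K: "L \<le> K" "0 < K"
  shows "unit_growth (\<lambda>x. (f x / K + x) / 2)"
proof -
  have lip: "\<bar>f x - f y\<bar> \<le> K * \<bar>x - y\<bar>" for x y
  proof -
    have "\<bar>f x - f y\<bar> \<le> L * \<bar>x - y\<bar>" using lipschitz_onD[OF assms(1)] by (simp add: dist_real_def)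
    also have "\<dots> \<le> K * \<bar>x - y\<bar>" using K by (intro mult_right_mono) auto
    finally show ?thesis .
  qed
  show ?thesis
  proof (standard; rule monoI)
    fix x y :: real assume "x \<le> y"
    then have *: "f x - f y \<le> K * (y - x)" "f y - f x \<le> K * (y - x)" using lip[of x y] by auto
    define g where "g = (\<lambda>x. f x / K)"
    have "g x - g y \<le> y - x" "g y - g x \<le> y - x"
      using * K(2) by (simp_all add: g_def diff_divide_distrib[symmetric] pos_divide_le_eq mult.commute)
    then have "(g x + x) / 2 \<le> (g y + y) / 2" "x - (g x + x) / 2 \<le> y - (g y + y) / 2" by (auto simp: field_simps)
    then show "(f x / K + x) / 2 \<le> (f y / K + y) / 2"
      "x - (f x / K + x) / 2 \<le> y - (f y / K + y) / 2" by (simp_all add: g_def)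
  qed
qed

lemma has_real_derivative_rescale:
  fixes f :: "real \<Rightarrow> real"
  assumes "K \<noteq> 0" and "((\<lambda>x. (f x / K + x) / 2) has_real_derivative D) (at x)"
  shows "(f has_real_derivative K * (2 * D - 1)) (at x)"
proof -
  have "((\<lambda>x. K * (2 * ((f x / K + x) / 2) - x)) has_real_derivative K * (2 * D - 1)) (at x)"
    by (rule DERIV_cmult[OF DERIV_diff[OF DERIV_cmult[OF assms(2)] DERIV_ident]])
  moreover have "(\<lambda>x. K * (2 * ((f x / K + x) / 2) - x)) = f" using assms(1) by (auto simp: field_simps)
  ultimately show ?thesis by simp
qed

lemma lipschitz_AE_differentiable:
  fixes f :: "real \<Rightarrow> real"
  assumes "L-lipschitz_on UNIV f"
  shows "AE x in lborel. \<exists>D. (f has_real_derivative D) (at x)"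
proof -
  have L: "0 < L + 1" using lipschitz_on_nonneg[OF assms] by simp
  interpret unit_growth "\<lambda>x. (f x / (L + 1) + x) / 2"
    by (rule unit_growth_of_lipschitz[OF assms]) (use L in auto)
  show ?thesis using AE_differentiable
  proof eventually_elim
    case (elim x)
    then obtain D where "((\<lambda>x. (f x / (L + 1) + x) / 2) has_real_derivative D) (at x)" by blast
    from has_real_derivative_rescale[OF _ this] L show ?case by auto
  qed
qed

lemma lipschitz_increment_le:
  fixes f :: "real \<Rightarrow> real"
  assumes lip: "L-lipschitz_on UNIV f" and ab: "a \<le> b"
    and ae: "AE x in lborel. a < x \<longrightarrow> x < b \<longrightarrow> (\<forall>D. (f has_real_derivative D) (at x) \<longrightarrow> D \<le> r)"
  shows "f b - f a \<le> r * (b - a)"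
proof -
  \<comment> \<open>Including \<open>\<bar>r\<bar>\<close> makes the rescaled bound
    \<open>(r / K + 1) / 2\<close> nonnegative, as \<open>increment_le\<close> requires.\<close>
  define K where "K = L + 1 + \<bar>r\<bar>"
  have K: "L \<le> K" "0 < K" "0 \<le> (r / K + 1) / 2"
    using lipschitz_on_nonneg[OF lip] by (auto simp: K_def field_simps)
  interpret unit_growth "\<lambda>x. (f x / K + x) / 2"
    by (rule unit_growth_of_lipschitz[OF lip]) (use K in auto)
  have "(f b / K + b) / 2 - (f a / K + a) / 2 \<le> (r / K + 1) / 2 * (b - a)"
  proof (rule increment_le[OF ab K(3)])
    show "AE x in lborel. a < x \<longrightarrow> x < b \<longrightarrow>
        (\<forall>D. ((\<lambda>x. (f x / K + x) / 2) has_real_derivative D) (at x) \<longrightarrow> D \<le> (r / K + 1) / 2)"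
      using ae
    proof eventually_elim
      case (elim x)
      show ?case
      proof (intro impI allI)
        fix D assume D: "a < x" "x < b" "((\<lambda>x. (f x / K + x) / 2) has_real_derivative D) (at x)"
        have "K * (2 * D - 1) \<le> r" using has_real_derivative_rescale[OF _ D(3)] K(2) elim D(1,2) by auto
        then show "D \<le> (r / K + 1) / 2" using K(2) by (simp add: field_simps)
      qed
    qed
  qed
  moreover have "(f b / K + b) / 2 - (f a / K + a) / 2 = ((f b - f a) / K + (b - a)) / 2"
    by (simp add: diff_divide_distrib add_divide_distrib)
  moreover have "(r / K + 1) / 2 * (b - a) = (r * (b - a) / K + (b - a)) / 2"
    by (simp add: algebra_simps diff_divide_distrib add_divide_distrib)
  ultimately have "((f b - f a) / K + (b - a)) / 2 \<le> (r * (b - a) / K + (b - a)) / 2" by simp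
  moreover have "u \<le> v" if "(u + d) / 2 \<le> (v + d) / 2" for u v d :: real using that by simp
  ultimately have "(f b - f a) / K \<le> r * (b - a) / K" by blast
  then show ?thesis using K(2) by (simp add: divide_le_cancel)
qed

section \<open>Paths on the half line and negative drift\<close>

lemma lipschitz_on_extend_halfline:
  fixes f :: "real \<Rightarrow> real"
  assumes "L-lipschitz_on {0..} f"
  shows "L-lipschitz_on UNIV (\<lambda>t. f (max 0 t))"
proof (rule lipschitz_onI)
  fix x y :: real
  have "dist (f (max 0 x)) (f (max 0 y)) \<le> L * dist (max 0 x) (max 0 y)"
    by (rule lipschitz_onD[OF assms]) auto
  also have "\<dots> \<le> L * dist x y"
    by (rule mult_left_mono[OF _ lipschitz_on_nonneg[OF assms]]) (auto simp: dist_real_def)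
  finally show "dist (f (max 0 x)) (f (max 0 y)) \<le> L * dist x y" .
qed (rule lipschitz_on_nonneg[OF assms])

lemma has_real_derivative_extend_halfline:
  fixes f :: "real \<Rightarrow> real"
  assumes "0 < t"
  shows "((\<lambda>t. f (max 0 t)) has_real_derivative D) (at t) \<longleftrightarrow> (f has_real_derivative D) (at t)"
proof (rule has_field_derivative_cong_ev)
  show "\<forall>\<^sub>F x in nhds t. x \<in> UNIV \<longrightarrow> f (max 0 x) = f x"
    using eventually_nhds_in_open[of "{0<..}" t] assms by (auto elim: eventually_mono)
qed (use assms in auto)

lemma lipschitz_halfline_AE_differentiable:
  fixes f :: "real \<Rightarrow> real"
  assumes "L-lipschitz_on {0..} f"
  shows "AE t in lborel. 0 < t \<longrightarrow> (\<exists>D. (f has_real_derivative D) (at t))"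
  using lipschitz_AE_differentiable[OF lipschitz_on_extend_halfline[OF assms]]
proof eventually_elim
  case (elim t)
  then show ?case using has_real_derivative_extend_halfline[of t f] by blast
qed

text \<open>While positive, \<open>f\<close> decreases at rate \<open>c\<close>. Hence it cannot
  leave 0 again after \<open>t0\<close>, and it cannot stay positive longer than
  \<open>f t0 / c\<close>.\<close>

lemma eventually_zero_of_negative_drift:
  fixes f :: "real \<Rightarrow> real"
  assumes lip: "L-lipschitz_on {0..} f" and nonneg: "\<And>t. 0 \<le> t \<Longrightarrow> 0 \<le> f t"
    and "0 \<le> t0" "0 < c"
    and drift: "AE t in lborel. t0 < t \<longrightarrow> 0 < f t \<longrightarrow> (\<exists>D. (f has_real_derivative D) (at t) \<and> D \<le> - c)"
  shows "\<exists>t1\<ge>t0. \<forall>t\<ge>t1. f t = 0"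
proof (intro exI conjI allI impI)
  let ?F = "\<lambda>t. f (max 0 t)"
  have decr: "f b - f a \<le> - c * (b - a)"
    if ab: "t0 \<le> a" "a \<le> b" and pos: "\<And>x. a < x \<Longrightarrow> x < b \<Longrightarrow> 0 < f x" for a b
  proof -
    have "?F b - ?F a \<le> - c * (b - a)"
    proof (rule lipschitz_increment_le[OF lipschitz_on_extend_halfline[OF lip] ab(2)])
      show "AE x in lborel. a < x \<longrightarrow> x < b \<longrightarrow> (\<forall>D. (?F has_real_derivative D) (at x) \<longrightarrow> D \<le> - c)"
        using drift
      proof eventually_elim
        case (elim x)
        show ?case
        proof (intro impI allI)
          fix D assume D: "a < x" "x < b" "(?F has_real_derivative D) (at x)"
          then have "0 < x" "t0 < x" using ab \<open>0 \<le> t0\<close> by auto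
          then have "(f has_real_derivative D) (at x)"
            using D(3) by (simp add: has_real_derivative_extend_halfline)
          moreover obtain D' where "(f has_real_derivative D') (at x)" "D' \<le> - c"
            using elim D \<open>t0 < x\<close> pos by blast
          ultimately show "D \<le> - c" using DERIV_unique by blast
        qed
      qed
    qed
    then show ?thesis using ab \<open>0 \<le> t0\<close> by simp
  qed
  \<comment> \<open>The witness is the time needed to drain \<open>f t0\<close> at rate
    \<open>c\<close>, plus one unit to make the contradiction strict.\<close>
  show "t0 \<le> t0 + f t0 / c + 1" using nonneg[of t0] \<open>0 \<le> t0\<close> \<open>0 < c\<close> by simp
  fix t assume t: "t0 + f t0 / c + 1 \<le> t"
  have t0t: "t0 < t" using t nonneg[of t0] \<open>0 \<le> t0\<close> \<open>0 < c\<close>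
    by (smt (verit) divide_nonneg_nonneg)
  show "f t = 0"
  proof (rule ccontr)
    assume "f t \<noteq> 0"
    then have ft: "0 < f t" using nonneg[of t] t0t \<open>0 \<le> t0\<close> by simp
    \<comment> \<open>The last zero before \<open>t\<close>, if there is one, starts an interval on
      which \<open>f\<close> is positive. Otherwise \<open>t0\<close> plays that part.\<close>
    define S where "S = {s \<in> {t0..t}. f s = 0}"
    have cont: "continuous_on {t0..t} f"
      using lipschitz_on_continuous_on[OF lip] \<open>0 \<le> t0\<close> by (auto intro: continuous_on_subset)
    have "closed S" unfolding S_def
      by (intro continuous_closed_preimage_constant) (use cont in auto)
    moreover have "bounded S" by (rule bounded_subset[of "{t0..t}"]) (auto simp: S_def)
    ultimately have "compact S" by (simp add: compact_eq_bounded_closed)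
    show False
    proof (cases "S = {}")
      case True
      then have "0 < f x" if "t0 < x" "x < t" for x
      proof -
        have "f x \<noteq> 0" using True that by (auto simp: S_def)
        then show ?thesis using nonneg[of x] that \<open>0 \<le> t0\<close> by linarith
      qed
      then have "f t - f t0 \<le> - c * (t - t0)" using decr[of t0 t] t0t by auto
      moreover have "f t0 + c \<le> c * (t - t0)" using t \<open>0 < c\<close> by (simp add: field_simps)
      ultimately show False using ft \<open>0 < c\<close> by simp
    next
      case False
      then obtain s where s: "s \<in> S" "\<And>x. x \<in> S \<Longrightarrow> x \<le> s"
        using compact_attains_sup[OF \<open>compact S\<close>] by blast
      then have "s < t" using ft by (auto simp: S_def order.strict_iff_order)
      have "0 < f x" if "s < x" "x < t" for x
      proof -
        have "t0 \<le> s" using s(1) by (simp add: S_def)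
        then have "f x \<noteq> 0" using s(2)[of x] that by (auto simp: S_def)
        then show ?thesis using nonneg[of x] that \<open>t0 \<le> s\<close> \<open>0 \<le> t0\<close> by linarith
      qed
      then have "f t - f s \<le> - c * (t - s)" using decr[of s t] s(1) by (auto simp: S_def)
      moreover have "0 < c * (t - s)" using \<open>s < t\<close> \<open>0 < c\<close> by simp
      ultimately show False using ft s(1) by (simp add: S_def)
    qed
  qed
qed

section \<open>A station with two classes\<close>

text \<open>
  Here \<open>a\<close>, \<open>b\<close> are the arrival rates and \<open>d\<close>, \<open>e\<close> the departure rates of the earlier and the later
  class.  The last disjunct describes an empty station.
\<close>

definition station_flow :: "real \<Rightarrow> real \<Rightarrow> real \<Rightarrow> real \<Rightarrow> real \<Rightarrow> real \<Rightarrow> real \<Rightarrow> real \<Rightarrow> bool" where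
  "station_flow \<mu> \<nu> p a b x d e \<longleftrightarrow>
    0 \<le> d \<and> 0 \<le> e \<and> \<mu> * d + \<nu> * e \<le> 1 \<and>
    (0 < x \<longrightarrow> \<mu> * d = 1 \<and> e = 0) \<and> (x < 0 \<longrightarrow> d = 0 \<and> \<nu> * e = 1) \<and>
    (x = 0 \<longrightarrow> (1 - p) * \<mu> * (a - d) = p * \<nu> * (b - e) \<and>
      (\<mu> * d + \<nu> * e = 1 \<or> d = a \<and> e = b))"

text \<open>If \<open>p = 1\<close> then \<open>x \<le> 0\<close>, and if \<open>p = 0\<close> then \<open>x \<ge> 0\<close>: the divisions by \<open>0\<close> yield the right value \<open>0\<close>.\<close>

definition surplus :: "real \<Rightarrow> (real \<Rightarrow> real) \<Rightarrow> real \<Rightarrow> real" where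
  "surplus p x t = max 0 (x t) / (1 - p)"

definition deficit :: "real \<Rightarrow> (real \<Rightarrow> real) \<Rightarrow> real \<Rightarrow> real" where
  "deficit p x t = max 0 (- x t) / p"

text \<open>The bounds are free of \<open>p\<close>, which is the purpose of dividing by
  \<open>1 - p\<close> and \<open>p\<close>. They are inequalities because arrivals to the other
  class of the station only lower the quantity.\<close>

definition station_drift :: "real \<Rightarrow> real \<Rightarrow> real \<Rightarrow> real \<Rightarrow> real \<Rightarrow> (real \<Rightarrow> real) \<Rightarrow> real \<Rightarrow> bool" where
  "station_drift \<mu> \<nu> p a b x t \<longleftrightarrow> (\<exists>u v.
    (surplus p x has_real_derivative u) (at t) \<and> (0 < x t \<longrightarrow> u \<le> \<mu> * a - 1) \<and> (x t \<le> 0 \<longrightarrow> u = 0) \<and>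
    (deficit p x has_real_derivative v) (at t) \<and> (x t < 0 \<longrightarrow> v \<le> \<nu> * b - 1) \<and> (0 \<le> x t \<longrightarrow> v = 0))"

locale station =
  fixes \<mu> \<nu> p :: real
  assumes pos: "0 < \<mu>" "0 < \<nu>" and sum: "\<mu> + \<nu> = 1" and p: "0 \<le> p" "p \<le> 1"
begin

section \<open>Service rates of a single station\<close>

lemma station_flow_le:
  assumes "station_flow \<mu> \<nu> p a b x d e"
  shows "d \<le> 1 / \<mu>" "e \<le> 1 / \<nu>"
proof -
  have "\<mu> * d \<le> 1" "\<nu> * e \<le> 1"
    using assms pos mult_nonneg_nonneg[of \<mu> d] mult_nonneg_nonneg[of \<nu> e]
    unfolding station_flow_def by linarith+
  then show "d \<le> 1 / \<mu>" "e \<le> 1 / \<nu>" using pos by (simp_all add: field_simps)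
qed

lemma station_flow_pos:
  assumes "station_flow \<mu> \<nu> p a b x d e" "0 < x"
  shows "d = 1 / \<mu>" "e = 0"
  using assms pos by (auto simp: station_flow_def field_simps)

lemma station_flow_neg:
  assumes "station_flow \<mu> \<nu> p a b x d e" "x < 0"
  shows "d = 0" "e = 1 / \<nu>"
  using assms pos by (auto simp: station_flow_def field_simps)

text \<open>Balance and full utilisation are two linear equations for the work rates
  \<open>\<mu> * d\<close> and \<open>\<nu> * e\<close>. Their solution is a pair of convex
  combinations with weights \<open>p\<close> and \<open>1 - p\<close>, so bounds uniform in
  \<open>p\<close> follow by bounding both ingredients.\<close>

lemma station_flow_zero:
  assumes "station_flow \<mu> \<nu> p a b x d e" "x = 0"
  shows "\<mu> * d = (1 - p) * (\<mu> * a) + p * (1 - \<nu> * b) \<and> \<nu> * e = p * (\<nu> * b) + (1 - p) * (1 - \<mu> * a) \<or>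
    d = a \<and> e = b"
proof (cases "d = a \<and> e = b")
  case False
  then have bal: "(1 - p) * \<mu> * (a - d) = p * \<nu> * (b - e)" and full: "\<nu> * e = 1 - \<mu> * d"
    using assms by (auto simp: station_flow_def)
  have "p * \<nu> * (b - e) = p * (\<nu> * b) - p * (1 - \<mu> * d)" unfolding full[symmetric] by (simp add: algebra_simps)
  moreover have "(1 - p) * \<mu> * (a - d) = (1 - p) * (\<mu> * a) - (1 - p) * (\<mu> * d)" by (simp add: algebra_simps)
  ultimately have "\<mu> * d = (1 - p) * (\<mu> * a) + p * (1 - \<nu> * b)"
    using bal by (simp add: algebra_simps)
  with full show ?thesis by (simp add: algebra_simps)
qed simp

lemma one_le_inverse: "1 \<le> 1 / \<mu>" "1 \<le> 1 / \<nu>"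
  using pos sum by (simp_all add: field_simps)

text \<open>For \<open>x < 0\<close> only the later class is served. For \<open>x = 0\<close> the
  convex combinations are compared with their values \<open>\<mu>\<close> and \<open>\<nu>\<close>
  at \<open>a = b = 1\<close>.\<close>

lemma station_flow_low:
  assumes fl: "station_flow \<mu> \<nu> p a b x d e" and "x \<le> 0" "a \<le> 1" "1 \<le> b"
  shows "d \<le> 1" "1 \<le> e"
proof -
  have "d \<le> 1 \<and> 1 \<le> e"
  proof (cases "x < 0")
    case True
    then show ?thesis using station_flow_neg[OF fl] one_le_inverse by simp
  next
    case False
    then have "x = 0" using assms by simp
    from station_flow_zero[OF fl this] show ?thesis
    proof
      assume eq: "\<mu> * d = (1 - p) * (\<mu> * a) + p * (1 - \<nu> * b) \<and> \<nu> * e = p * (\<nu> * b) + (1 - p) * (1 - \<mu> * a)"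
      have le: "\<mu> * a \<le> \<mu>" "\<nu> \<le> \<nu> * b" using assms pos by simp_all
      have "\<mu> * d \<le> (1 - p) * \<mu> + p * (1 - \<nu>)"
        using eq le p by (simp add: add_mono mult_left_mono)
      also have "\<dots> = \<mu> * 1" using sum by (simp add: algebra_simps flip: sum)
      finally have 1: "d \<le> 1" using pos by (simp only: mult_le_cancel_left_pos)
      have "\<nu> * 1 = p * \<nu> + (1 - p) * (1 - \<mu>)" using sum by (simp add: algebra_simps flip: sum)
      also have "\<dots> \<le> \<nu> * e" using eq le p by (simp add: add_mono mult_left_mono)
      finally show ?thesis using 1 pos by (simp only: mult_le_cancel_left_pos)
    qed (use assms in simp)
  qed
  then show "d \<le> 1" "1 \<le> e" by simp_all
qed

text \<open>Both ingredients of the convex combination for \<open>\<mu> * d\<close> are at least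
  \<open>\<mu> * z\<close>: the second one because \<open>1 - \<nu> * b\<close> is at least
  \<open>\<mu>\<close>.\<close>

lemma station_flow_high_left:
  assumes fl: "station_flow \<mu> \<nu> p a b x d e" and "0 \<le> x" "z \<le> a" "z \<le> 1" "b \<le> 1"
  shows "z \<le> d"
proof (cases "0 < x")
  case True
  then show ?thesis using station_flow_pos[OF fl] one_le_inverse assms by simp
next
  case False
  then have "x = 0" using assms by simp
  from station_flow_zero[OF fl this] show ?thesis
  proof
    assume eq: "\<mu> * d = (1 - p) * (\<mu> * a) + p * (1 - \<nu> * b) \<and> \<nu> * e = p * (\<nu> * b) + (1 - p) * (1 - \<mu> * a)"
    have "\<mu> * z \<le> \<mu> * a" "\<mu> * z \<le> \<mu> * 1" "\<nu> * b \<le> \<nu> * 1"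
      using assms pos by (simp_all only: mult_le_cancel_left_pos)
    then have "(1 - p) * (\<mu> * z) \<le> (1 - p) * (\<mu> * a)" "p * (\<mu> * z) \<le> p * (1 - \<nu> * b)"
      using p sum by (auto intro!: mult_left_mono)
    moreover have "\<mu> * z = (1 - p) * (\<mu> * z) + p * (\<mu> * z)" by (simp add: algebra_simps)
    ultimately have "\<mu> * z \<le> \<mu> * d" using eq by linarith
    then show ?thesis using pos by simp
  qed (use assms in simp)
qed

text \<open>A shortage \<open>\<delta>\<close> of the earlier class frees capacity that lets the
  later class depart faster. The lemma quantifies how shortage and excess are handed to the next
  station.\<close>

lemma station_flow_high_right:
  assumes fl: "station_flow \<mu> \<nu> p a b x d e" and "0 \<le> x" "1 - \<delta> \<le> a" "b \<le> 1 + \<eta>" "0 \<le> \<delta>" "0 \<le> \<eta>"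
  shows "e \<le> 1 + \<eta> + \<mu> / \<nu> * \<delta>"
proof -
  have pr: "0 \<le> \<mu> / \<nu> * \<delta>" using pos assms by simp
  show ?thesis
  proof (cases "0 < x")
    case True
    then show ?thesis using station_flow_pos[OF fl] assms pr by simp
  next
    case False
    then have "x = 0" using assms by simp
    from station_flow_zero[OF fl this] show ?thesis
    proof
      assume eq: "\<mu> * d = (1 - p) * (\<mu> * a) + p * (1 - \<nu> * b) \<and> \<nu> * e = p * (\<nu> * b) + (1 - p) * (1 - \<mu> * a)"
      \<comment> \<open>Chosen to dominate both ingredients \<open>\<nu> * b\<close> and
        \<open>1 - \<mu> * a\<close> of the convex combination.\<close>
      define y where "y = \<nu> * (1 + \<eta>) + \<mu> * \<delta>"
      have a: "\<mu> * (1 - \<delta>) \<le> \<mu> * a" and b: "\<nu> * b \<le> \<nu> * (1 + \<eta>)"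
        using assms pos by (simp_all only: mult_le_cancel_left_pos)
      have nn: "0 \<le> \<mu> * \<delta>" "0 \<le> \<nu> * \<eta>" using pos assms by simp_all
      have "\<nu> * b \<le> y" using b nn by (simp add: y_def)
      moreover have "1 - \<mu> * a \<le> y" using a nn sum by (simp add: y_def algebra_simps)
      ultimately have "p * (\<nu> * b) + (1 - p) * (1 - \<mu> * a) \<le> p * y + (1 - p) * y"
        using p by (intro add_mono mult_left_mono) auto
      then have "\<nu> * e \<le> y" using eq by (simp add: algebra_simps)
      also have "y = \<nu> * (1 + \<eta> + \<mu> / \<nu> * \<delta>)" using pos by (simp add: y_def field_simps)
      finally show ?thesis using pos by simp
    qed (use assms pr in simp)
  qed
qed

end

section \<open>Drift of surplus and deficit\<close>

lemma lipschitz_on_max0: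
  fixes f :: "'a::metric_space \<Rightarrow> real"
  assumes "L-lipschitz_on S f"
  shows "L-lipschitz_on S (\<lambda>t. max 0 (f t))"
proof (rule lipschitz_onI)
  fix x y assume "x \<in> S" "y \<in> S"
  have "dist (max 0 (f x)) (max 0 (f y)) \<le> dist (f x) (f y)" by (auto simp: dist_real_def)
  also have "\<dots> \<le> L * dist x y" by (rule lipschitz_onD[OF assms]) fact+
  finally show "dist (max 0 (f x)) (max 0 (f y)) \<le> L * dist x y" .
qed (rule lipschitz_on_nonneg[OF assms])

lemma lipschitz_surplus:
  assumes "\<exists>L. L-lipschitz_on {0..} x"
  shows "\<exists>L. L-lipschitz_on {0..} (surplus p x)"
proof -
  obtain L where "L-lipschitz_on {0..} x" using assms by blast
  then have "(\<bar>inverse (1 - p)\<bar> * L)-lipschitz_on {0..} (\<lambda>t. inverse (1 - p) * max 0 (x t))"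
    by (intro lipschitz_on_cmult_real lipschitz_on_max0)
  moreover have "surplus p x = (\<lambda>t. inverse (1 - p) * max 0 (x t))"
    by (auto simp: surplus_def field_simps)
  ultimately show ?thesis by auto
qed

lemma lipschitz_deficit:
  assumes "\<exists>L. L-lipschitz_on {0..} x"
  shows "\<exists>L. L-lipschitz_on {0..} (deficit p x)"
proof -
  obtain L where "L-lipschitz_on {0..} x" using assms by blast
  then have "L-lipschitz_on {0..} (\<lambda>t. - x t)" by simp
  then have "\<exists>L. L-lipschitz_on {0..} (surplus (1 - p) (\<lambda>t. - x t))" by (intro lipschitz_surplus) blast
  moreover have "surplus (1 - p) (\<lambda>t. - x t) = deficit p x" by (auto simp: surplus_def deficit_def)
  ultimately show ?thesis by simp
qed

lemma DERIV_zero_at_global_min: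
  fixes f :: "real \<Rightarrow> real"
  assumes "(f has_real_derivative D) (at t)" "0 < t" "f t = 0" "\<And>s. 0 \<le> s \<Longrightarrow> 0 \<le> f s"
  shows "D = 0"
  using assms by (intro DERIV_local_min[OF assms(1) assms(2)]) (auto simp: abs_less_iff)

context station
begin

text \<open>Turns the pointwise fluid conditions at one time into the two predicates. Nonnegative
  functions that vanish at \<open>t\<close> and are differentiable there have derivative 0, which
  yields both the balance equation at \<open>x t = 0\<close> and the rates of an empty
  station.\<close>

lemma station_at:
  fixes z w :: "real \<Rightarrow> real"
  assumes x_def: "x = (\<lambda>t. (1 - p) * \<mu> * z t - p * \<nu> * w t)" and t: "0 < t"
    and z: "(z has_real_derivative a - d) (at t)" "\<And>s. 0 \<le> s \<Longrightarrow> 0 \<le> z s"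
    and w: "(w has_real_derivative b - e) (at t)" "\<And>s. 0 \<le> s \<Longrightarrow> 0 \<le> w s"
    and nonneg: "0 \<le> a" "0 \<le> b" "0 \<le> d" "0 \<le> e" and cap: "\<mu> * d + \<nu> * e \<le> 1"
    and pri: "0 < x t \<Longrightarrow> \<mu> * d = 1 \<and> e = 0" "x t < 0 \<Longrightarrow> d = 0 \<and> \<nu> * e = 1"
    and work: "0 < \<mu> * z t + \<nu> * w t \<Longrightarrow> \<mu> * d + \<nu> * e = 1"
    and diff: "\<exists>D. (surplus p x has_real_derivative D) (at t)" "\<exists>D. (deficit p x has_real_derivative D) (at t)"
  shows "station_flow \<mu> \<nu> p a b (x t) d e \<and> station_drift \<mu> \<nu> p a b x t"
proof -
  have x: "(x has_real_derivative (1 - p) * \<mu> * (a - d) - p * \<nu> * (b - e)) (at t)"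
    unfolding x_def by (intro DERIV_diff DERIV_cmult z w)
  \<comment> \<open>Guards the division by \<open>1 - p\<close>: a share \<open>p = 1\<close>
    excludes a positive imbalance.\<close>
  have p1: "p < 1" if "0 < x s" "0 \<le> s" for s
  proof (rule ccontr)
    assume "\<not> p < 1"
    then have "p = 1" using p by simp
    then have "x s \<le> 0" using w(2)[OF that(2)] pos by (simp add: x_def)
    with that show False by simp
  qed
  have p0: "0 < p" if "x s < 0" "0 \<le> s" for s
  proof (rule ccontr)
    assume "\<not> 0 < p"
    then have "p = 0" using p by simp
    then have "0 \<le> x s" using z(2)[OF that(2)] pos by (simp add: x_def)
    with that show False by simp
  qed
  have an: "0 \<le> surplus p x s" "0 \<le> deficit p x s" for s using p by (simp_all add: surplus_def deficit_def)
  obtain u v where u: "(surplus p x has_real_derivative u) (at t)" and v: "(deficit p x has_real_derivative v) (at t)"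
    using diff by blast
  have isc: "isCont x t" using x by (rule DERIV_isCont)
  have u0: "u = 0" if "x t \<le> 0"
    using that by (intro DERIV_zero_at_global_min[OF u t _ an(1)]) (simp add: surplus_def)
  have v0: "v = 0" if "0 \<le> x t"
    using that by (intro DERIV_zero_at_global_min[OF v t _ an(2)]) (simp add: deficit_def)
  have upos: "u \<le> \<mu> * a - 1" if xt: "0 < x t"
  proof -
    have q: "p < 1" using p1[OF xt] t by simp
    have "\<forall>\<^sub>F s in nhds t. 0 < x s"
      using isc xt unfolding isCont_def tendsto_at_iff_tendsto_nhds by (rule order_tendstoD)
    then have ev: "\<forall>\<^sub>F s in nhds t. s \<in> UNIV \<longrightarrow> surplus p x s = x s / (1 - p)"
      by eventually_elim (simp add: surplus_def)
    have "((\<lambda>s. x s / (1 - p)) has_real_derivative u) (at t)"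
      using u has_field_derivative_cong_ev[OF refl ev refl refl, of u] xt by (simp add: surplus_def)
    moreover have "((\<lambda>s. x s / (1 - p)) has_real_derivative
        ((1 - p) * \<mu> * (a - d) - p * \<nu> * (b - e)) / (1 - p)) (at t)"
      using x by (rule DERIV_cdivide)
    ultimately have "u = ((1 - p) * \<mu> * (a - d) - p * \<nu> * (b - e)) / (1 - p)" by (rule DERIV_unique)
    also have "\<dots> = (\<mu> * a - \<mu> * d) - p * \<nu> * (b - e) / (1 - p)"
      using q by (simp add: field_simps)
    also have "\<dots> = \<mu> * a - 1 - p * \<nu> * b / (1 - p)" using pri(1)[OF xt] by simp
    also have "\<dots> \<le> \<mu> * a - 1" using p q pos nonneg by simp
    finally show ?thesis .
  qed
  have vneg: "v \<le> \<nu> * b - 1" if xt: "x t < 0"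
  proof -
    have q: "0 < p" using p0[OF xt] t by simp
    have "\<forall>\<^sub>F s in nhds t. x s < 0"
      using isc xt unfolding isCont_def tendsto_at_iff_tendsto_nhds by (rule order_tendstoD)
    then have ev: "\<forall>\<^sub>F s in nhds t. s \<in> UNIV \<longrightarrow> deficit p x s = - x s / p"
      by eventually_elim (simp add: deficit_def)
    have "((\<lambda>s. - x s / p) has_real_derivative v) (at t)"
      using v has_field_derivative_cong_ev[OF refl ev refl refl, of v] xt by (simp add: deficit_def)
    moreover have "((\<lambda>s. - x s / p) has_real_derivative
        - ((1 - p) * \<mu> * (a - d) - p * \<nu> * (b - e)) / p) (at t)"
      using DERIV_minus[OF x] by (rule DERIV_cdivide)
    ultimately have "v = - ((1 - p) * \<mu> * (a - d) - p * \<nu> * (b - e)) / p" by (rule DERIV_unique)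
    also have "\<dots> = (\<nu> * b - \<nu> * e) - (1 - p) * \<mu> * (a - d) / p"
      using q by (simp add: field_simps)
    also have "\<dots> = \<nu> * b - 1 - (1 - p) * \<mu> * a / p" using pri(2)[OF xt] by simp
    also have "\<dots> \<le> \<nu> * b - 1" using p q pos nonneg by simp
    finally show ?thesis .
  qed
  \<comment> \<open>The imbalance is \<open>1 - p\<close> times surplus minus \<open>p\<close> times
    deficit. At \<open>x t = 0\<close> both have derivative 0, so the derivative of \<open>x\<close>
    vanishes too.\<close>
  have bal: "(1 - p) * \<mu> * (a - d) = p * \<nu> * (b - e)" if "x t = 0"
  proof -
    have eq: "x s = (1 - p) * surplus p x s - p * deficit p x s" if "0 \<le> s" for s
      using p1[of s] p0[of s] that by (cases "0 < x s"; cases "x s < 0") (auto simp: surplus_def deficit_def)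
    have "\<forall>\<^sub>F s in nhds t. 0 < s"
      using eventually_nhds_in_open[of "{0<..}" t] t by simp
    then have ev: "\<forall>\<^sub>F s in nhds t. s \<in> UNIV \<longrightarrow> (1 - p) * surplus p x s - p * deficit p x s = x s"
      by eventually_elim (simp add: eq)
    have "((\<lambda>s. (1 - p) * surplus p x s - p * deficit p x s) has_real_derivative (1 - p) * u - p * v) (at t)"
      by (intro DERIV_diff DERIV_cmult u v)
    then have "(x has_real_derivative (1 - p) * u - p * v) (at t)"
      using has_field_derivative_cong_ev[OF refl ev refl refl] eq[of t] t by simp
    then have "(1 - p) * \<mu> * (a - d) - p * \<nu> * (b - e) = (1 - p) * u - p * v"
      using x DERIV_unique by blast
    then show ?thesis using u0 v0 that by simp
  qed
  \<comment> \<open>At an empty station both queues are at their minimum 0, so departures equal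
    arrivals class by class.\<close>
  have idle: "\<mu> * d + \<nu> * e = 1 \<or> d = a \<and> e = b"
  proof (cases "0 < \<mu> * z t + \<nu> * w t")
    case False
    have "0 \<le> \<mu> * z t" "0 \<le> \<nu> * w t" using z(2)[of t] w(2)[of t] t pos by simp_all
    with False have "\<mu> * z t = 0" "\<nu> * w t = 0" by linarith+
    then have "z t = 0" "w t = 0" using pos by simp_all
    then have "a - d = 0" "b - e = 0"
      using DERIV_zero_at_global_min[OF z(1) t _ z(2)] DERIV_zero_at_global_min[OF w(1) t _ w(2)] by simp_all
    then show ?thesis by simp
  qed (simp add: work)
  show ?thesis
    using nonneg cap pri bal idle u v u0 v0 upos vneg
    unfolding station_flow_def station_drift_def by auto
qed

end

section \<open>The imbalances of the DHV network\<close>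

text \<open>The factor in \<open>heavy\<close> bounds the departure rates of classes 4 and 5 in
  \<open>high1\<close> and \<open>high2\<close>. The assumption says that arrivals at that rate
  bring less than one unit of work per unit time to classes 5 and 6. In \<open>rates\<close> the
  departures of each class are the arrivals of the next one on the route.\<close>

locale dhv_dynamics =
  st1: station m1 m4 p1 + st2: station m2 m5 p2 + st3: station m3 m6 p3
  for m1 m2 m3 m4 m5 m6 p1 p2 p3 :: real +
  fixes \<alpha> :: real and x1 x2 x3 :: "real \<Rightarrow> real"
  assumes \<alpha>: "0 \<le> \<alpha>" "\<alpha> \<le> 1"
    and heavy: "m5 * (1 + (m1 / m4 + m2 / m5) * (1 - \<alpha>)) < 1" "m6 * (1 + (m1 / m4 + m2 / m5) * (1 - \<alpha>)) < 1"
    and lip: "\<exists>L. L-lipschitz_on {0..} x1" "\<exists>L. L-lipschitz_on {0..} x2" "\<exists>L. L-lipschitz_on {0..} x3"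
    and surplus_iff: "\<And>t. 0 \<le> t \<Longrightarrow> surplus p1 x1 t = 0 \<longleftrightarrow> x1 t \<le> 0"
      "\<And>t. 0 \<le> t \<Longrightarrow> surplus p2 x2 t = 0 \<longleftrightarrow> x2 t \<le> 0" "\<And>t. 0 \<le> t \<Longrightarrow> surplus p3 x3 t = 0 \<longleftrightarrow> x3 t \<le> 0"
    and deficit_iff: "\<And>t. 0 \<le> t \<Longrightarrow> deficit p1 x1 t = 0 \<longleftrightarrow> 0 \<le> x1 t"
      "\<And>t. 0 \<le> t \<Longrightarrow> deficit p2 x2 t = 0 \<longleftrightarrow> 0 \<le> x2 t" "\<And>t. 0 \<le> t \<Longrightarrow> deficit p3 x3 t = 0 \<longleftrightarrow> 0 \<le> x3 t"
    and rates: "AE t in lborel. 0 < t \<longrightarrow> (\<exists>d1 d2 d3 d4 d5 d6.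
      station_flow m1 m4 p1 \<alpha> d3 (x1 t) d1 d4 \<and> station_drift m1 m4 p1 \<alpha> d3 x1 t \<and>
      station_flow m2 m5 p2 d1 d4 (x2 t) d2 d5 \<and> station_drift m2 m5 p2 d1 d4 x2 t \<and>
      station_flow m3 m6 p3 d2 d5 (x3 t) d3 d6 \<and> station_drift m3 m6 p3 d2 d5 x3 t)"
begin

definition flows :: "real \<Rightarrow> real \<Rightarrow> real \<Rightarrow> real \<Rightarrow> real \<Rightarrow> real \<Rightarrow> real \<Rightarrow> bool" where
  "flows t d1 d2 d3 d4 d5 d6 \<longleftrightarrow> station_flow m1 m4 p1 \<alpha> d3 (x1 t) d1 d4 \<and>
    station_flow m2 m5 p2 d1 d4 (x2 t) d2 d5 \<and> station_flow m3 m6 p3 d2 d5 (x3 t) d3 d6"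

lemma surplus_nonneg: "0 \<le> surplus p1 x1 t" "0 \<le> surplus p2 x2 t" "0 \<le> surplus p3 x3 t"
  using st1.p st2.p st3.p by (simp_all add: surplus_def)

lemma deficit_nonneg: "0 \<le> deficit p1 x1 t" "0 \<le> deficit p2 x2 t" "0 \<le> deficit p3 x3 t"
  using st1.p st2.p st3.p by (simp_all add: deficit_def)

lemma surplus_pos: "0 < surplus p1 x1 t \<Longrightarrow> 0 < x1 t" "0 < surplus p2 x2 t \<Longrightarrow> 0 < x2 t" "0 < surplus p3 x3 t \<Longrightarrow> 0 < x3 t"
  by (auto simp: surplus_def zero_less_divide_iff split: if_splits)

lemma deficit_pos: "0 < deficit p1 x1 t \<Longrightarrow> x1 t < 0" "0 < deficit p2 x2 t \<Longrightarrow> x2 t < 0" "0 < deficit p3 x3 t \<Longrightarrow> x3 t < 0"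
  by (auto simp: deficit_def zero_less_divide_iff split: if_splits)

text \<open>Absorbs the almost-everywhere quantifier and the choice of rates, so that the later
  drift estimates are purely pointwise.\<close>

lemma eventually_zero:
  assumes "0 \<le> t0" "0 < c" "\<exists>L. L-lipschitz_on {0..} F" "\<And>t. 0 \<le> F t"
    and "\<And>t d1 d2 d3 d4 d5 d6. t0 < t \<Longrightarrow> 0 < t \<Longrightarrow> 0 < F t \<Longrightarrow> flows t d1 d2 d3 d4 d5 d6 \<Longrightarrow>
      station_drift m1 m4 p1 \<alpha> d3 x1 t \<Longrightarrow> station_drift m2 m5 p2 d1 d4 x2 t \<Longrightarrow>
      station_drift m3 m6 p3 d2 d5 x3 t \<Longrightarrow> \<exists>D. (F has_real_derivative D) (at t) \<and> D \<le> - c"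
  shows "\<exists>t1\<ge>t0. \<forall>t\<ge>t1. F t = 0"
proof -
  obtain L where "L-lipschitz_on {0..} F" using assms(3) by blast
  then show ?thesis
  proof (rule eventually_zero_of_negative_drift[OF _ assms(4) assms(1,2)])
    show "AE t in lborel. t0 < t \<longrightarrow> 0 < F t \<longrightarrow> (\<exists>D. (F has_real_derivative D) (at t) \<and> D \<le> - c)"
      using rates
    proof eventually_elim
      case (elim t)
      show ?case
      proof (intro impI)
        assume *: "t0 < t" "0 < F t"
        then have "0 < t" using assms(1) by simp
        with elim obtain d1 d2 d3 d4 d5 d6 where
          "station_flow m1 m4 p1 \<alpha> d3 (x1 t) d1 d4" "station_drift m1 m4 p1 \<alpha> d3 x1 t"
          "station_flow m2 m5 p2 d1 d4 (x2 t) d2 d5" "station_drift m2 m5 p2 d1 d4 x2 t"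
          "station_flow m3 m6 p3 d2 d5 (x3 t) d3 d6" "station_drift m3 m6 p3 d2 d5 x3 t" by blast
        then show "\<exists>D. (F has_real_derivative D) (at t) \<and> D \<le> - c"
          using assms(5)[OF *(1) \<open>0 < t\<close> *(2)] unfolding flows_def by blast
      qed
    qed
  qed
qed

lemma drift_surplus: "station_drift \<mu> \<nu> p a b x t \<Longrightarrow> 0 < x t \<Longrightarrow> \<mu> * a - 1 \<le> - c \<Longrightarrow>
    \<exists>D. (surplus p x has_real_derivative D) (at t) \<and> D \<le> - c"
  unfolding station_drift_def by fastforce

lemma drift_deficit: "station_drift \<mu> \<nu> p a b x t \<Longrightarrow> x t < 0 \<Longrightarrow> \<nu> * b - 1 \<le> - c \<Longrightarrow>
    \<exists>D. (deficit p x has_real_derivative D) (at t) \<and> D \<le> - c"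
  unfolding station_drift_def by fastforce

section \<open>Rate bounds passed along the route\<close>

text \<open>The lemmas \<open>low1\<close>, \<open>low2\<close>, \<open>low3\<close> form a chain
  for nonpositive imbalances: \<open>1 \<le> d3\<close> gives \<open>d1 \<le> 1 \<le> d4\<close>,
  this gives \<open>d2 \<le> 1 \<le> d5\<close>, and this gives \<open>d3 \<le> 1\<close>. A
  strictly negative imbalance enters the chain at its own station.\<close>

lemma low1:
  assumes "flows t d1 d2 d3 d4 d5 d6" "x1 t \<le> 0" "x1 t < 0 \<or> 1 \<le> d3"
  shows "d1 \<le> 1" "1 \<le> d4"
proof -
  have fl: "station_flow m1 m4 p1 \<alpha> d3 (x1 t) d1 d4" using assms by (simp add: flows_def)
  have "d1 \<le> 1 \<and> 1 \<le> d4"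
    using st1.station_flow_low[OF fl assms(2) \<alpha>(2)] st1.station_flow_neg[OF fl] st1.one_le_inverse assms(3)
    by auto
  then show "d1 \<le> 1" "1 \<le> d4" by simp_all
qed

lemma low2:
  assumes "flows t d1 d2 d3 d4 d5 d6" "x2 t \<le> 0" "x2 t < 0 \<or> d1 \<le> 1 \<and> 1 \<le> d4"
  shows "d2 \<le> 1" "1 \<le> d5"
proof -
  have fl: "station_flow m2 m5 p2 d1 d4 (x2 t) d2 d5" using assms by (simp add: flows_def)
  have "d2 \<le> 1 \<and> 1 \<le> d5"
    using st2.station_flow_low[OF fl assms(2)] st2.station_flow_neg[OF fl] st2.one_le_inverse assms(3)
    by auto
  then show "d2 \<le> 1" "1 \<le> d5" by simp_all
qed

lemma low3:
  assumes "flows t d1 d2 d3 d4 d5 d6" "x3 t \<le> 0" "x3 t < 0 \<or> d2 \<le> 1 \<and> 1 \<le> d5"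
  shows "d3 \<le> 1"
proof -
  have fl: "station_flow m3 m6 p3 d2 d5 (x3 t) d3 d6" using assms by (simp add: flows_def)
  show ?thesis
    using st3.station_flow_low[OF fl assms(2)] st3.station_flow_neg[OF fl] st3.one_le_inverse assms(3)
    by auto
qed

text \<open>The shortage \<open>1 - \<alpha>\<close> of exogenous arrivals is the only source of
  excess at class 4. The last bound is weakened to the common factor of
  \<open>heavy\<close>.\<close>

lemma high1:
  assumes "flows t d1 d2 d3 d4 d5 d6" "x1 t = 0" "d3 \<le> 1"
  shows "\<alpha> \<le> d1" "d4 \<le> 1 + m1 / m4 * (1 - \<alpha>)" "d4 \<le> 1 + (m1 / m4 + m2 / m5) * (1 - \<alpha>)"
proof -
  have fl: "station_flow m1 m4 p1 \<alpha> d3 (x1 t) d1 d4" using assms by (simp add: flows_def)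
  show "\<alpha> \<le> d1" using st1.station_flow_high_left[OF fl _ order_refl \<alpha>(2)] assms by simp
  show d4: "d4 \<le> 1 + m1 / m4 * (1 - \<alpha>)"
    using st1.station_flow_high_right[OF fl, of "1 - \<alpha>" 0] \<alpha> assms by simp
  have "0 \<le> m2 / m5 * (1 - \<alpha>)" using st2.pos \<alpha> by simp
  with d4 show "d4 \<le> 1 + (m1 / m4 + m2 / m5) * (1 - \<alpha>)" by (simp add: distrib_right)
qed

text \<open>Station 2 passes on the excess of \<open>d4\<close> and adds \<open>m2 / m5\<close>
  times the shortage of \<open>d1\<close>, which is again at most
  \<open>1 - \<alpha>\<close>.\<close>

lemma high2:
  assumes fl: "flows t d1 d2 d3 d4 d5 d6" and x: "x1 t = 0" "x2 t = 0" "d3 \<le> 1"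
  shows "d5 \<le> 1 + (m1 / m4 + m2 / m5) * (1 - \<alpha>)"
proof -
  have fl2: "station_flow m2 m5 p2 d1 d4 (x2 t) d2 d5" using fl by (simp add: flows_def)
  have "0 \<le> m1 / m4 * (1 - \<alpha>)" using st1.pos \<alpha> by simp
  then have "d5 \<le> 1 + m1 / m4 * (1 - \<alpha>) + m2 / m5 * (1 - \<alpha>)"
    using st2.station_flow_high_right[OF fl2, of "1 - \<alpha>" "m1 / m4 * (1 - \<alpha>)"] high1[OF fl x(1,3)] x \<alpha> by simp
  then show ?thesis by (simp add: distrib_right)
qed

text \<open>With \<open>0 < x2 t\<close> only class 2 is served at station 2, so class 3 receives
  arrivals at rate at least 1 and class 6 receives none.\<close>

lemma high3:
  assumes fl: "flows t d1 d2 d3 d4 d5 d6" and x: "0 < x2 t" "0 \<le> x3 t"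
  shows "1 \<le> d3"
proof -
  have "station_flow m2 m5 p2 d1 d4 (x2 t) d2 d5" using fl by (simp add: flows_def)
  from st2.station_flow_pos[OF this x(1)] have d: "1 \<le> d2" "d5 \<le> 1"
    using st2.one_le_inverse by simp_all
  have "station_flow m3 m6 p3 d2 d5 (x3 t) d3 d6" using fl by (simp add: flows_def)
  then show ?thesis by (rule st3.station_flow_high_left[OF _ x(2) d(1) order_refl d(2)])
qed

lemma service_times_less_one: "m1 < 1" "m2 < 1" "m3 < 1" "m4 < 1" "m5 < 1" "m6 < 1"
  using st1.pos st1.sum st2.pos st2.sum st3.pos st3.sum by linarith+

lemma mult_le_of_le_one: "0 < m \<Longrightarrow> d \<le> 1 \<Longrightarrow> m * d \<le> (m::real)"
  using mult_left_mono[of d 1 m] by simp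

section \<open>Draining the imbalances one after the other\<close>

text \<open>The arrivals at class 1 are exogenous and bring work at rate at most \<open>m1\<close>,
  which is below 1, so its surplus drains whatever happens elsewhere.\<close>

lemma eventually_x1_le_0: "\<exists>t1\<ge>0. \<forall>t\<ge>t1. x1 t \<le> 0"
proof -
  have "\<exists>t1\<ge>0. \<forall>t\<ge>t1. surplus p1 x1 t = 0"
  proof (rule eventually_zero[where c = "1 - m1"])
    fix t d1 d2 d3 d4 d5 d6
    assume "0 < surplus p1 x1 t" and dr: "station_drift m1 m4 p1 \<alpha> d3 x1 t"
    then show "\<exists>D. (surplus p1 x1 has_real_derivative D) (at t) \<and> D \<le> - (1 - m1)"
      using mult_le_of_le_one[OF st1.pos(1) \<alpha>(2)] by (intro drift_surplus[OF dr] surplus_pos) auto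
  qed (use service_times_less_one lipschitz_surplus[OF lip(1)] surplus_nonneg in auto)
  then show ?thesis using surplus_iff(1) by (metis order_trans)
qed

text \<open>The remaining parts vanish in the order surplus 3, deficit 1, deficit 2, deficit 3. Each
  drift bound uses the signs secured before it.\<close>

lemma collapse_of_x1_x2_le_0:
  assumes "0 \<le> t0" and x1: "\<And>t. t0 \<le> t \<Longrightarrow> x1 t \<le> 0" and x2: "\<And>t. t0 \<le> t \<Longrightarrow> x2 t \<le> 0"
  shows "\<exists>t1\<ge>0. \<forall>t\<ge>t1. x1 t = 0 \<and> x2 t = 0 \<and> x3 t = 0"
proof -
  let ?k = "1 + (m1 / m4 + m2 / m5) * (1 - \<alpha>)"
  have "\<exists>t1\<ge>t0. \<forall>t\<ge>t1. surplus p3 x3 t = 0"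
  proof (rule eventually_zero[where c = "1 - m3"])
    fix t d1 d2 d3 d4 d5 d6
    assume t: "t0 < t" and "0 < surplus p3 x3 t" and fl: "flows t d1 d2 d3 d4 d5 d6"
      and dr: "station_drift m3 m6 p3 d2 d5 x3 t"
    then have x3: "0 < x3 t" by (intro surplus_pos)
    have "1 \<le> d3" using fl st3.station_flow_pos(1)[OF _ x3] st3.one_le_inverse by (auto simp: flows_def)
    then have "d2 \<le> 1" using low2[OF fl x2] low1[OF fl x1] t by auto
    then show "\<exists>D. (surplus p3 x3 has_real_derivative D) (at t) \<and> D \<le> - (1 - m3)"
      using mult_le_of_le_one[OF st3.pos(1)] by (intro drift_surplus[OF dr x3]) auto
  qed (use service_times_less_one lipschitz_surplus[OF lip(3)] surplus_nonneg assms(1) in auto)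
  then obtain t1 where t1: "t0 \<le> t1" and x3: "\<And>t. t1 \<le> t \<Longrightarrow> x3 t \<le> 0"
    using surplus_iff(3) assms(1) by (metis order_trans)
  \<comment> \<open>Here \<open>x1 t < 0\<close> enters the chain, which ends in
    \<open>d3 \<le> 1\<close>, so class 4 receives work at rate at most \<open>m4\<close>.\<close>
  have "\<exists>t2\<ge>t1. \<forall>t\<ge>t2. deficit p1 x1 t = 0"
  proof (rule eventually_zero[where c = "1 - m4"])
    fix t d1 d2 d3 d4 d5 d6
    assume t: "t1 < t" and "0 < deficit p1 x1 t" and fl: "flows t d1 d2 d3 d4 d5 d6"
      and dr: "station_drift m1 m4 p1 \<alpha> d3 x1 t"
    then have x: "x1 t < 0" by (intro deficit_pos)
    have "d3 \<le> 1" using low3[OF fl x3] low2[OF fl x2] low1[OF fl x1] x t t1 by auto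
    then show "\<exists>D. (deficit p1 x1 has_real_derivative D) (at t) \<and> D \<le> - (1 - m4)"
      using mult_le_of_le_one[OF st1.pos(2)] by (intro drift_deficit[OF dr x]) auto
  qed (use service_times_less_one lipschitz_deficit[OF lip(1)] deficit_nonneg assms(1) t1 in auto)
  then obtain t2 where t2: "t1 \<le> t2" and x1': "\<And>t. t2 \<le> t \<Longrightarrow> x1 t = 0"
    using deficit_iff(1) x1 t1 assms(1) by (metis order_antisym order_trans)
  \<comment> \<open>Now \<open>x2 t < 0\<close> itself supplies \<open>d3 \<le> 1\<close> through
    \<open>low2\<close> and \<open>low3\<close>. Since station 1 is already balanced,
    \<open>high1\<close> then bounds the arrivals at class 5.\<close>
  have "\<exists>t3\<ge>t2. \<forall>t\<ge>t3. deficit p2 x2 t = 0"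
  proof (rule eventually_zero[where c = "1 - m5 * ?k"])
    fix t d1 d2 d3 d4 d5 d6
    assume t: "t2 < t" and "0 < deficit p2 x2 t" and fl: "flows t d1 d2 d3 d4 d5 d6"
      and dr: "station_drift m2 m5 p2 d1 d4 x2 t"
    then have x: "x2 t < 0" by (intro deficit_pos)
    have "d3 \<le> 1" using low3[OF fl x3] low2[OF fl x2] x t t1 t2 by auto
    then have "d4 \<le> ?k" using high1(3)[OF fl x1'] t by auto
    then have "m5 * d4 \<le> m5 * ?k" using st2.pos by (intro mult_left_mono) auto
    then show "\<exists>D. (deficit p2 x2 has_real_derivative D) (at t) \<and> D \<le> - (1 - m5 * ?k)"
      by (intro drift_deficit[OF dr x]) auto
  qed (use heavy lipschitz_deficit[OF lip(2)] deficit_nonneg assms(1) t1 t2 in auto)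
  then obtain t3 where t3: "t2 \<le> t3" and x2': "\<And>t. t3 \<le> t \<Longrightarrow> x2 t = 0"
    using deficit_iff(2) x2 t1 t2 assms(1) by (metis order_antisym order_trans)
  have "\<exists>t4\<ge>t3. \<forall>t\<ge>t4. deficit p3 x3 t = 0"
  proof (rule eventually_zero[where c = "1 - m6 * ?k"])
    fix t d1 d2 d3 d4 d5 d6
    assume t: "t3 < t" and "0 < deficit p3 x3 t" and fl: "flows t d1 d2 d3 d4 d5 d6"
      and dr: "station_drift m3 m6 p3 d2 d5 x3 t"
    then have x: "x3 t < 0" by (intro deficit_pos)
    have "d3 \<le> 1" using low3[OF fl] x by auto
    then have "d5 \<le> ?k" using high2[OF fl x1' x2'] t t3 by auto
    then have "m6 * d5 \<le> m6 * ?k" using st3.pos by (intro mult_left_mono) auto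
    then show "\<exists>D. (deficit p3 x3 has_real_derivative D) (at t) \<and> D \<le> - (1 - m6 * ?k)"
      by (intro drift_deficit[OF dr x]) auto
  qed (use heavy lipschitz_deficit[OF lip(3)] deficit_nonneg assms(1) t1 t2 t3 in auto)
  then obtain t4 where t4: "t3 \<le> t4" and x3': "\<And>t. t4 \<le> t \<Longrightarrow> x3 t = 0"
    using deficit_iff(3) x3 t1 t2 t3 assms(1) by (metis order_antisym order_trans)
  show ?thesis
    using x1' x2' x3' t1 t2 t3 t4 assms(1) by (intro exI[of _ t4]) auto
qed

text \<open>Class 1 departs at rate at most \<open>1 / m1\<close>, so class 2 receives work at rate
  at most \<open>m2 / m1\<close>, which is below 1, and the surplus of station 2 drains.\<close>

lemma collapse_fast_class_2:
  assumes "m2 < m1"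
  shows "\<exists>t1\<ge>0. \<forall>t\<ge>t1. x1 t = 0 \<and> x2 t = 0 \<and> x3 t = 0"
proof -
  obtain t0 where t0: "0 \<le> t0" and x1: "\<And>t. t0 \<le> t \<Longrightarrow> x1 t \<le> 0" using eventually_x1_le_0 by blast
  have "\<exists>t1\<ge>t0. \<forall>t\<ge>t1. surplus p2 x2 t = 0"
  proof (rule eventually_zero[where c = "1 - m2 / m1"])
    fix t d1 d2 d3 d4 d5 d6
    assume "0 < surplus p2 x2 t" and fl: "flows t d1 d2 d3 d4 d5 d6"
      and dr: "station_drift m2 m5 p2 d1 d4 x2 t"
    then have x: "0 < x2 t" by (intro surplus_pos)
    have "d1 \<le> 1 / m1" using fl st1.station_flow_le by (auto simp: flows_def)
    then have "m2 * d1 \<le> m2 / m1" using st2.pos mult_left_mono[of d1 "1 / m1" m2] by simp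
    then show "\<exists>D. (surplus p2 x2 has_real_derivative D) (at t) \<and> D \<le> - (1 - m2 / m1)"
      by (intro drift_surplus[OF dr x]) auto
  qed (use assms st1.pos lipschitz_surplus[OF lip(2)] surplus_nonneg t0 in auto)
  then obtain t1 where "t0 \<le> t1" and x2: "\<And>t. t1 \<le> t \<Longrightarrow> x2 t \<le> 0"
    using surplus_iff(2) t0 by (metis order_trans)
  then show ?thesis using collapse_of_x1_x2_le_0[of t1] t0 x1 by auto
qed

text \<open>Work reaches class 6 at rate at most \<open>m6 / m5\<close>, so the deficit of station 3
  drains first. Once \<open>0 \<le> x3 t\<close>, a surplus at station 2 forces
  \<open>1 \<le> d3\<close> and thereby \<open>d1 \<le> 1\<close>, so it drains as well.\<close>

lemma collapse_fast_class_6: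
  assumes "m6 < m5"
  shows "\<exists>t1\<ge>0. \<forall>t\<ge>t1. x1 t = 0 \<and> x2 t = 0 \<and> x3 t = 0"
proof -
  obtain t0 where t0: "0 \<le> t0" and x1: "\<And>t. t0 \<le> t \<Longrightarrow> x1 t \<le> 0" using eventually_x1_le_0 by blast
  have "\<exists>t1\<ge>t0. \<forall>t\<ge>t1. deficit p3 x3 t = 0"
  proof (rule eventually_zero[where c = "1 - m6 / m5"])
    fix t d1 d2 d3 d4 d5 d6
    assume "0 < deficit p3 x3 t" and fl: "flows t d1 d2 d3 d4 d5 d6"
      and dr: "station_drift m3 m6 p3 d2 d5 x3 t"
    then have x: "x3 t < 0" by (intro deficit_pos)
    have "d5 \<le> 1 / m5" using fl st2.station_flow_le by (auto simp: flows_def)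
    then have "m6 * d5 \<le> m6 / m5" using st3.pos mult_left_mono[of d5 "1 / m5" m6] by simp
    then show "\<exists>D. (deficit p3 x3 has_real_derivative D) (at t) \<and> D \<le> - (1 - m6 / m5)"
      by (intro drift_deficit[OF dr x]) auto
  qed (use assms st2.pos lipschitz_deficit[OF lip(3)] deficit_nonneg t0 in auto)
  then obtain t1 where t1: "t0 \<le> t1" and x3: "\<And>t. t1 \<le> t \<Longrightarrow> 0 \<le> x3 t"
    using deficit_iff(3) t0 by (metis order_trans)
  have "\<exists>t2\<ge>t1. \<forall>t\<ge>t2. surplus p2 x2 t = 0"
  proof (rule eventually_zero[where c = "1 - m2"])
    fix t d1 d2 d3 d4 d5 d6
    assume t: "t1 < t" and "0 < surplus p2 x2 t" and fl: "flows t d1 d2 d3 d4 d5 d6"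
      and dr: "station_drift m2 m5 p2 d1 d4 x2 t"
    then have x: "0 < x2 t" by (intro surplus_pos)
    have "1 \<le> d3" using high3[OF fl x] x3 t by auto
    then have "d1 \<le> 1" using low1[OF fl x1] t t1 by auto
    then show "\<exists>D. (surplus p2 x2 has_real_derivative D) (at t) \<and> D \<le> - (1 - m2)"
      using mult_le_of_le_one[OF st2.pos(1)] by (intro drift_surplus[OF dr x]) auto
  qed (use service_times_less_one lipschitz_surplus[OF lip(2)] surplus_nonneg t0 t1 in auto)
  then obtain t2 where "t1 \<le> t2" and x2: "\<And>t. t2 \<le> t \<Longrightarrow> x2 t \<le> 0"
    using surplus_iff(2) t0 t1 by (metis order_trans)
  then show ?thesis using collapse_of_x1_x2_le_0[of t2] t0 t1 x1 by auto
qed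

section \<open>The Lyapunov function of the critical case\<close>

text \<open>A check of the twelve sign patterns with \<open>x1 t \<le> 0\<close>. In patterns 1, 5
  and 7 one term of the cycle may grow at its maximal rate while another drains at full speed, and
  the weights leave \<open>- \<sigma>\<close> over a product of two service times. In patterns 3 and
  12 the growth is absorbed by a term with weight \<open>B\<close>.\<close>

lemma lyapunov_rate:
  assumes fl: "flows t d1 d2 d3 d4 d5 d6" and x1: "x1 t \<le> 0" and nz: "x1 t \<noteq> 0 \<or> x2 t \<noteq> 0 \<or> x3 t \<noteq> 0"
    and order: "m5 \<le> m4" "m5 \<le> m6"
    and k: "k = 1 + (m1 / m4 + m2 / m5) * (1 - \<alpha>)"
    and \<sigma>: "\<sigma> = 2 - m2 - m4 - m6"
    and B: "1 \<le> B" "m4 / m3 / m5 \<le> B * m6" "m6 / m5 / m1 \<le> B * (1 - m5 * k)"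
    and c: "c \<le> \<sigma> / (m3 * m5)" "c \<le> \<sigma> / (m1 * m5)" "c \<le> \<sigma> / (m1 * m3)"
      "c \<le> 1 / m3" "c \<le> 1 / m5" "c \<le> 1 / m1" "c \<le> m1 / m5" "c \<le> m5 / m3" "c \<le> m6"
      "c \<le> (1 - m6 * k) / m1" "c \<le> 1 - m5 * k"
    and v1: "x1 t < 0 \<Longrightarrow> v1 \<le> m4 * d3 - 1" "0 \<le> x1 t \<Longrightarrow> v1 = 0"
    and u2: "0 < x2 t \<Longrightarrow> u2 \<le> m2 * d1 - 1" "x2 t \<le> 0 \<Longrightarrow> u2 = 0"
    and v2: "x2 t < 0 \<Longrightarrow> v2 \<le> m5 * d4 - 1" "0 \<le> x2 t \<Longrightarrow> v2 = 0"
    and u3: "0 < x3 t \<Longrightarrow> u3 \<le> m3 * d2 - 1" "x3 t \<le> 0 \<Longrightarrow> u3 = 0"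
    and v3: "x3 t < 0 \<Longrightarrow> v3 \<le> m6 * d5 - 1" "0 \<le> x3 t \<Longrightarrow> v3 = 0"
  shows "v1 / m5 + u2 / m3 + v3 / m1 + B * (u3 + v2) \<le> - c"
proof -
  have f1: "station_flow m1 m4 p1 \<alpha> d3 (x1 t) d1 d4" and f2: "station_flow m2 m5 p2 d1 d4 (x2 t) d2 d5"
    and f3: "station_flow m3 m6 p3 d2 d5 (x3 t) d3 d6" using fl by (simp_all add: flows_def)
  note pos = st1.pos st2.pos st3.pos
  note sums = st1.sum st2.sum st3.sum
  note le = st1.station_flow_le[OF f1] st2.station_flow_le[OF f2] st3.station_flow_le[OF f3]
  have mul: "m4 * d3 \<le> m4 / m3" "m2 * d1 \<le> m2 / m1" "m5 * d4 \<le> m5 / m4" "m3 * d2 \<le> m3 / m2" "m6 * d5 \<le> m6 / m5"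
    using le pos mult_left_mono[of d3 "1 / m3" m4] mult_left_mono[of d1 "1 / m1" m2] mult_left_mono[of d4 "1 / m4" m5]
      mult_left_mono[of d2 "1 / m2" m3] mult_left_mono[of d5 "1 / m5" m6] by simp_all
  \<comment> \<open>By normalisation \<open>m5 \<le> m6\<close> means \<open>m3 \<le> m2\<close>.
    The two ratios show that the terms weighted by \<open>B\<close> never grow.\<close>
  have ratio: "m5 / m4 \<le> 1" "m3 / m2 \<le> 1" using order pos sums by simp_all
  \<comment> \<open>Replacing two of \<open>m2\<close>, \<open>m4\<close>, \<open>m6\<close> by
    their complements gives the numerators that appear in \<open>K1\<close>, \<open>K2\<close>,
    \<open>K3\<close>.\<close>
  have \<sigma>': "\<sigma> = m3 + m5 - m4" "\<sigma> = m1 + m5 - m6" "\<sigma> = m1 + m3 - m2" using \<sigma> sums by linarith+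
  have K1: "(m4 / m3 - 1) / m5 + - 1 / m3 = - \<sigma> / (m3 * m5)"
    using pos unfolding \<sigma>'(1) by (simp add: field_simps)
  have K2: "(m6 / m5 - 1) / m1 + - 1 / m5 = - \<sigma> / (m1 * m5)"
    using pos unfolding \<sigma>'(2) by (simp add: field_simps)
  have K3: "(m2 / m1 - 1) / m3 + - 1 / m1 = - \<sigma> / (m1 * m3)"
    using pos unfolding \<sigma>'(3) by (simp add: field_simps)
  have v2': "v2 \<le> 0" using v2 mul ratio by (cases "x2 t < 0") auto
  have u3': "u3 \<le> 0" using u3 mul ratio by (cases "0 < x3 t") auto
  have Bn: "B * y \<le> y" "B * y \<le> 0" if "y \<le> 0" for y
    using that B(1) mult_right_mono_neg[of 1 B y] by auto
  have B0: "B * (u3 + v2) \<le> 0" "B * (u3 + v2) \<le> B * u3" "B * (u3 + v2) \<le> B * v2"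
    using u3' v2' B(1) Bn(2)[OF u3'] Bn(2)[OF v2'] by (simp_all add: distrib_left)
  have div: "v1 / m5 \<le> y / m5" if "v1 \<le> y" for y using that pos by (simp add: divide_right_mono)
  have div2: "u2 / m3 \<le> y / m3" if "u2 \<le> y" for y using that pos by (simp add: divide_right_mono)
  have div3: "v3 / m1 \<le> y / m1" if "v3 \<le> y" for y using that pos by (simp add: divide_right_mono)
  have le1: "m3 * y \<le> m3" "m4 * y \<le> m4" "m2 * y \<le> m2" if "y \<le> 1" for y
    using that pos mult_le_of_le_one by auto
  have k5: "m5 * y \<le> m5 * k" "m6 * y \<le> m6 * k" if "y \<le> k" for y
    using that pos by (simp_all add: mult_left_mono)
  consider "x1 t < 0" "0 < x2 t" "0 \<le> x3 t" | "x1 t < 0" "0 < x2 t" "x3 t < 0"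
    | "x1 t < 0" "x2 t \<le> 0" "0 < x3 t" | "x1 t < 0" "x2 t \<le> 0" "x3 t = 0" | "x1 t < 0" "x2 t \<le> 0" "x3 t < 0"
    | "x1 t = 0" "0 < x2 t" "0 \<le> x3 t" | "x1 t = 0" "0 < x2 t" "x3 t < 0"
    | "x1 t = 0" "x2 t = 0" "0 < x3 t" | "x1 t = 0" "x2 t = 0" "x3 t < 0"
    | "x1 t = 0" "x2 t < 0" "0 < x3 t" | "x1 t = 0" "x2 t < 0" "x3 t = 0" | "x1 t = 0" "x2 t < 0" "x3 t < 0"
    using x1 nz by argo
  then show ?thesis
  proof cases
    case 1
    have "v1 / m5 \<le> (m4 / m3 - 1) / m5" using v1(1)[OF 1(1)] mul by (intro div) linarith
    moreover have "u2 / m3 \<le> - 1 / m3"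
      using u2(1)[OF 1(2)] st1.station_flow_neg[OF f1 1(1)] by (intro div2) simp
    moreover have "v3 = 0" using v3 1 by simp
    ultimately show ?thesis using K1 B0(1) c(1) by simp
  next
    case 2
    have d3: "d3 = 0" using st3.station_flow_neg[OF f3 2(3)] by simp
    have d5: "d5 = 0" using st2.station_flow_pos[OF f2 2(2)] by simp
    have "v1 / m5 \<le> 0 / m5" using v1(1)[OF 2(1)] d3 by (intro div) simp
    moreover have "v3 / m1 \<le> 0 / m1" using v3(1)[OF 2(3)] d5 by (intro div3) simp
    moreover have "u2 / m3 \<le> - 1 / m3"
      using u2(1)[OF 2(2)] st1.station_flow_neg[OF f1 2(1)] by (intro div2) simp
    ultimately show ?thesis using B0(1) c(4) by simp
  next
    \<comment> \<open>The deficit of station 1 may grow although station 2 has no surplus that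
      drains. The surplus of station 3 does drain, at rate at least \<open>m6\<close>, and the first
      lower bound on \<open>B\<close> makes this prevail.\<close>
    case 3
    have "d2 \<le> 1" using low2[OF fl 3(2)] low1[OF fl x1] 3(1) by auto
    then have "u3 \<le> - m6" using u3(1)[OF 3(3)] le1(1)[of d2] sums by linarith
    then have "B * u3 \<le> B * - m6" using B(1) by (intro mult_left_mono) auto
    then have "B * (u3 + v2) \<le> - (m4 / m3 / m5)" using B0(2) B(2) by simp
    moreover have "v1 / m5 \<le> (m4 / m3 - 1) / m5" using v1(1)[OF 3(1)] mul by (intro div) linarith
    moreover have "u2 = 0" "v3 = 0" using u2 v3 3 by simp_all
    ultimately show ?thesis using c(5) by (simp add: diff_divide_distrib)
  next
    case 4
    have "d3 \<le> 1" using low3[OF fl] low2[OF fl 4(2)] low1[OF fl x1] 4(1,3) by auto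
    then have "v1 / m5 \<le> - m1 / m5" using v1(1)[OF 4(1)] le1(2)[of d3] sums by (intro div) linarith
    moreover have "u2 = 0" "v3 = 0" using u2 v3 4 by simp_all
    ultimately show ?thesis using B0(1) c(7) by simp
  next
    case 5
    have d3: "d3 = 0" using st3.station_flow_neg[OF f3 5(3)] by simp
    have "v1 / m5 \<le> - 1 / m5" using v1(1)[OF 5(1)] d3 by (intro div) simp
    moreover have "v3 / m1 \<le> (m6 / m5 - 1) / m1" using v3(1)[OF 5(3)] mul by (intro div3) linarith
    moreover have "u2 = 0" using u2 5 by simp
    ultimately show ?thesis using K2 B0(1) c(2) by simp
  next
    case 6
    have "d1 \<le> 1" using low1[OF fl x1] high3[OF fl 6(2,3)] by simp
    then have "u2 / m3 \<le> - m5 / m3" using u2(1)[OF 6(2)] le1(3)[of d1] sums by (intro div2) linarith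
    moreover have "v1 = 0" "v3 = 0" using v1 v3 6 by simp_all
    ultimately show ?thesis using B0(1) c(8) by simp
  next
    case 7
    have d5: "d5 = 0" using st2.station_flow_pos[OF f2 7(2)] by simp
    have "v3 / m1 \<le> - 1 / m1" using v3(1)[OF 7(3)] d5 by (intro div3) simp
    moreover have "u2 / m3 \<le> (m2 / m1 - 1) / m3" using u2(1)[OF 7(2)] mul by (intro div2) linarith
    moreover have "v1 = 0" using v1 7 by simp
    ultimately show ?thesis using K3 B0(1) c(3) by simp
  next
    case 8
    have "d3 = 1 / m3" using st3.station_flow_pos[OF f3 8(3)] by simp
    then have "d2 \<le> 1" using low2[OF fl] low1[OF fl x1] st3.one_le_inverse 8 by auto
    then have "u3 \<le> - m6" using u3(1)[OF 8(3)] le1(1)[of d2] sums by linarith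
    then have "B * (u3 + v2) \<le> - m6" using B0(2) Bn(1)[OF u3'] by linarith
    moreover have "v1 = 0" "u2 = 0" "v3 = 0" using v1 u2 v3 8 by simp_all
    ultimately show ?thesis using c(9) by simp
  next
    case 9
    have "d3 = 0" using st3.station_flow_neg[OF f3 9(3)] by simp
    then have "d5 \<le> k" using high2[OF fl 9(1,2)] k by simp
    then have "v3 / m1 \<le> - (1 - m6 * k) / m1" using v3(1)[OF 9(3)] k5(2)[of d5] by (intro div3) linarith
    also have "\<dots> \<le> - c" using c(10) by (simp only: minus_divide_left[symmetric] neg_le_iff_le)
    finally have "v3 / m1 \<le> - c" .
    moreover have "v1 = 0" "u2 = 0" using v1 u2 9 by simp_all
    ultimately show ?thesis using B0(1) by simp
  next
    case 10
    have "d2 = 0" using st2.station_flow_neg[OF f2 10(2)] by simp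
    then have "u3 \<le> - m6" using u3(1)[OF 10(3)] service_times_less_one by simp
    then have "B * (u3 + v2) \<le> - m6" using B0(2) Bn(1)[OF u3'] by linarith
    moreover have "v1 = 0" "u2 = 0" "v3 = 0" using v1 u2 v3 10 by simp_all
    ultimately show ?thesis using c(9) by simp
  next
    case 11
    have "d3 \<le> 1" using low3[OF fl] low2[OF fl] 11 by auto
    then have "d4 \<le> k" using high1(3)[OF fl 11(1)] k by simp
    then have "v2 \<le> - (1 - m5 * k)" using v2(1)[OF 11(2)] k5(1)[of d4] by linarith
    then have "B * (u3 + v2) \<le> - (1 - m5 * k)" using B0(3) Bn(1)[OF v2'] by linarith
    moreover have "v1 = 0" "u2 = 0" "v3 = 0" using v1 u2 v3 11 by simp_all
    ultimately show ?thesis using c(11) by simp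
  next
    \<comment> \<open>The deficit of station 3 may grow while that of station 2 drains at rate at
      least \<open>1 - m5 * k\<close>; this is what the second lower bound on \<open>B\<close> is
      for.\<close>
    case 12
    have "d3 = 0" using st3.station_flow_neg[OF f3 12(3)] by simp
    then have "d4 \<le> k" using high1(3)[OF fl 12(1)] k by simp
    then have "v2 \<le> - (1 - m5 * k)" using v2(1)[OF 12(2)] k5(1)[of d4] by linarith
    then have "B * v2 \<le> B * - (1 - m5 * k)" using B(1) by (intro mult_left_mono) auto
    then have "B * (u3 + v2) \<le> - (m6 / m5 / m1)" using B0(3) B(3) by (simp only: mult_minus_right)
    moreover have "v3 / m1 \<le> (m6 / m5 - 1) / m1" using v3(1)[OF 12(3)] mul by (intro div3) linarith
    moreover have "v1 = 0" "u2 = 0" using v1 u2 12 by simp_all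
    ultimately show ?thesis using c(6) by (simp add: diff_divide_distrib)
  qed
qed

lemma collapse_critical:
  assumes order: "m5 \<le> m4" "m5 \<le> m6" and virtual: "m2 + m4 + m6 < 2"
  shows "\<exists>t1\<ge>0. \<forall>t\<ge>t1. x1 t = 0 \<and> x2 t = 0 \<and> x3 t = 0"
proof -
  define k where "k = 1 + (m1 / m4 + m2 / m5) * (1 - \<alpha>)"
  define \<sigma> where "\<sigma> = 2 - m2 - m4 - m6"
  note pos = st1.pos st2.pos st3.pos
  have hk: "0 < 1 - m5 * k" "0 < 1 - m6 * k" using heavy by (simp_all add: k_def)
  have \<sigma>: "0 < \<sigma>" using virtual by (simp add: \<sigma>_def)
  \<comment> \<open>Each summand secures one of the three lower bounds required of
    \<open>B\<close>.\<close>
  define B where "B = 1 + m4 / m3 / m5 / m6 + m6 / m5 / m1 / (1 - m5 * k)"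
  have nn: "0 \<le> m4 / m3 / m5 / m6" "0 \<le> m6 / m5 / m1 / (1 - m5 * k)" using pos hk by simp_all
  have B1: "1 \<le> B" using nn by (simp add: B_def)
  have "m4 / m3 / m5 / m6 * m6 \<le> B * m6" using nn pos by (intro mult_right_mono) (simp_all add: B_def)
  then have B2: "m4 / m3 / m5 \<le> B * m6" using pos by simp
  have "m6 / m5 / m1 / (1 - m5 * k) * (1 - m5 * k) \<le> B * (1 - m5 * k)"
    using nn hk by (intro mult_right_mono) (simp_all add: B_def)
  then have B3: "m6 / m5 / m1 \<le> B * (1 - m5 * k)" using hk by simp
  \<comment> \<open>The guaranteed decrease in the individual sign patterns. All entries are
    positive because of \<open>0 < \<sigma>\<close> and \<open>heavy\<close>.\<close>
  define S where "S = {\<sigma> / (m3 * m5), \<sigma> / (m1 * m5), \<sigma> / (m1 * m3), 1 / m3, 1 / m5, 1 / m1, m1 / m5, m5 / m3, m6,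
    (1 - m6 * k) / m1, 1 - m5 * k}"
  define c where "c = Min S"
  have fin: "finite S" "S \<noteq> {}" by (simp_all add: S_def)
  have "0 < c" using fin pos hk \<sigma> by (simp add: c_def) (simp add: S_def)
  have cle: "c \<le> y" if "y \<in> S" for y using fin that by (simp add: c_def)
  \<comment> \<open>The surplus of station 1 is absent: it vanishes from \<open>t0\<close>
    on.\<close>
  define V where "V = (\<lambda>t. deficit p1 x1 t / m5 + surplus p2 x2 t / m3 + deficit p3 x3 t / m1 +
    B * (surplus p3 x3 t + deficit p2 x2 t))"
  obtain t0 where t0: "0 \<le> t0" and x1: "\<And>t. t0 \<le> t \<Longrightarrow> x1 t \<le> 0" using eventually_x1_le_0 by blast
  have nonneg: "0 \<le> deficit p1 x1 t / m5" "0 \<le> surplus p2 x2 t / m3" "0 \<le> deficit p3 x3 t / m1"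
    "0 \<le> B * surplus p3 x3 t" "0 \<le> B * deficit p2 x2 t" for t
    using pos B1 surplus_nonneg deficit_nonneg by simp_all
  have Vn: "0 \<le> V t" for t using nonneg[of t] by (simp add: V_def distrib_left)
  have "\<exists>t1\<ge>t0. \<forall>t\<ge>t1. V t = 0"
  proof (rule eventually_zero[OF t0 \<open>0 < c\<close> _ Vn])
    obtain L1 L2 L3 L4 L5 where L: "L1-lipschitz_on {0..} (deficit p1 x1)" "L2-lipschitz_on {0..} (surplus p2 x2)"
      "L3-lipschitz_on {0..} (deficit p3 x3)" "L4-lipschitz_on {0..} (surplus p3 x3)" "L5-lipschitz_on {0..} (deficit p2 x2)"
      using lipschitz_surplus lipschitz_deficit lip by meson
    have "(\<bar>1 / m5\<bar> * L1 + \<bar>1 / m3\<bar> * L2 + \<bar>1 / m1\<bar> * L3 + \<bar>B\<bar> * (L4 + L5))-lipschitz_on {0..}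
        (\<lambda>t. 1 / m5 * deficit p1 x1 t + 1 / m3 * surplus p2 x2 t + 1 / m1 * deficit p3 x3 t +
          B * (surplus p3 x3 t + deficit p2 x2 t))"
      by (intro lipschitz_on_add lipschitz_on_cmult_real L)
    then show "\<exists>L. L-lipschitz_on {0..} V" by (auto simp: V_def)
  next
    fix t d1 d2 d3 d4 d5 d6
    assume t: "t0 < t" "0 < t" and V: "0 < V t" and fl: "flows t d1 d2 d3 d4 d5 d6"
      and dr: "station_drift m1 m4 p1 \<alpha> d3 x1 t" "station_drift m2 m5 p2 d1 d4 x2 t" "station_drift m3 m6 p3 d2 d5 x3 t"
    obtain v1 where v1: "(deficit p1 x1 has_real_derivative v1) (at t)"
      "x1 t < 0 \<Longrightarrow> v1 \<le> m4 * d3 - 1" "0 \<le> x1 t \<Longrightarrow> v1 = 0"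
      using dr(1) unfolding station_drift_def by blast
    obtain u2 v2 where u2: "(surplus p2 x2 has_real_derivative u2) (at t)"
      "0 < x2 t \<Longrightarrow> u2 \<le> m2 * d1 - 1" "x2 t \<le> 0 \<Longrightarrow> u2 = 0"
      and v2: "(deficit p2 x2 has_real_derivative v2) (at t)"
      "x2 t < 0 \<Longrightarrow> v2 \<le> m5 * d4 - 1" "0 \<le> x2 t \<Longrightarrow> v2 = 0"
      using dr(2) unfolding station_drift_def by blast
    obtain u3 v3 where u3: "(surplus p3 x3 has_real_derivative u3) (at t)"
      "0 < x3 t \<Longrightarrow> u3 \<le> m3 * d2 - 1" "x3 t \<le> 0 \<Longrightarrow> u3 = 0"
      and v3: "(deficit p3 x3 has_real_derivative v3) (at t)"
      "x3 t < 0 \<Longrightarrow> v3 \<le> m6 * d5 - 1" "0 \<le> x3 t \<Longrightarrow> v3 = 0"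
      using dr(3) unfolding station_drift_def by blast
    have "(V has_real_derivative v1 / m5 + u2 / m3 + v3 / m1 + B * (u3 + v2)) (at t)"
      unfolding V_def by (intro DERIV_add DERIV_cmult DERIV_cdivide v1 u2 v2 u3 v3)
    moreover have "x1 t \<noteq> 0 \<or> x2 t \<noteq> 0 \<or> x3 t \<noteq> 0"
      using V by (auto simp: V_def surplus_def deficit_def)
    then have "v1 / m5 + u2 / m3 + v3 / m1 + B * (u3 + v2) \<le> - c"
      using x1[of t] t
      by (intro lyapunov_rate[OF fl _ _ order k_def \<sigma>_def B1 B2 B3] cle v1(2,3) u2(2,3) v2(2,3) u3(2,3) v3(2,3))
        (simp_all add: S_def)
    ultimately show "\<exists>D. (V has_real_derivative D) (at t) \<and> D \<le> - c" by blast
  qed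
  then obtain t1 where t1: "t0 \<le> t1" and V0: "\<And>t. t1 \<le> t \<Longrightarrow> V t = 0" by blast
  have "x1 t = 0 \<and> x2 t = 0 \<and> x3 t = 0" if "t1 \<le> t" for t
  proof -
    have t: "0 \<le> t" "t0 \<le> t" using that t0 t1 by auto
    have "deficit p1 x1 t / m5 = 0" "surplus p2 x2 t / m3 = 0" "deficit p3 x3 t / m1 = 0"
      "B * surplus p3 x3 t = 0" "B * deficit p2 x2 t = 0"
      using V0[OF that] nonneg[of t] unfolding V_def distrib_left by linarith+
    then have "deficit p1 x1 t = 0" "surplus p2 x2 t = 0" "deficit p3 x3 t = 0" "surplus p3 x3 t = 0" "deficit p2 x2 t = 0"
      using pos B1 by simp_all
    then show ?thesis
      using surplus_iff(2,3)[OF t(1)] deficit_iff[OF t(1)] x1[OF t(2)] by linarith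
  qed
  then show ?thesis using t0 t1 by (intro exI[of _ t1]) auto
qed

theorem collapse:
  assumes "m2 + m4 + m6 < 2"
  shows "\<exists>t1\<ge>0. \<forall>t\<ge>t1. x1 t = 0 \<and> x2 t = 0 \<and> x3 t = 0"
proof -
  \<comment> \<open>By normalisation the failure of \<open>m2 < m1\<close> is
    \<open>m5 \<le> m4\<close>, so the three cases are exhaustive.\<close>
  have "m2 < m1 \<or> m6 < m5 \<or> m5 \<le> m4 \<and> m5 \<le> m6" using st1.sum st2.sum by linarith
  then show ?thesis
    using collapse_fast_class_2 collapse_fast_class_6 collapse_critical[OF _ _ assms] by blast
qed

end

section \<open>Fluid solutions of the DHV network\<close>

text \<open>\<open>matrix_inv\<close> is defined by choice. A two-sided inverse makes its defining
  property available, and uniqueness of inverses does the rest.\<close>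

lemma matrix_inv_eqI:
  fixes A :: "real ^ 'n ^ 'n"
  assumes "A ** B = mat 1" "B ** A = mat 1"
  shows "matrix_inv A = B"
proof -
  have "A ** matrix_inv A = mat 1 \<and> matrix_inv A ** A = mat 1"
    unfolding matrix_inv_def using assms by (intro someI[of "\<lambda>X. A ** X = mat 1 \<and> X ** A = mat 1" B]) auto
  then have "matrix_inv A = B ** (A ** matrix_inv A)"
    by (metis assms(2) matrix_mul_assoc matrix_mul_lid)
  then show ?thesis using \<open>A ** matrix_inv A = mat 1 \<and> matrix_inv A ** A = mat 1\<close> by (simp add: matrix_mul_rid)
qed

lemma service_matrix_mult_vec: "service_matrix m *v x = (\<chi> k. m $ k * x $ k)"
  by (simp add: vec_eq_iff matrix_vector_mult_def service_matrix_def if_distrib[of "\<lambda>c. c * _"] cong: if_cong)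

lemma matrix_inv_service_matrix:
  fixes m :: "real ^ 'k"
  assumes "\<And>k. m $ k \<noteq> 0"
  shows "matrix_inv (service_matrix m) = service_matrix (\<chi> k. 1 / m $ k)"
proof -
  have "service_matrix a ** service_matrix b = mat 1"
    if "\<And>k. a $ k * b $ k = 1" for a b :: "real ^ 'k"
  proof -
    have "(service_matrix a ** service_matrix b) *v x = mat 1 *v x" for x
      using that by (simp add: matrix_vector_mul_assoc[symmetric] service_matrix_mult_vec vec_eq_iff
          mult.assoc[symmetric])
    then show ?thesis by (simp add: matrix_eq)
  qed
  then show ?thesis using assms by (intro matrix_inv_eqI) simp_all
qed

lemma constituency_matrix_mult_vec:
  "constituency_matrix s *v x = (\<chi> j. \<Sum>k\<in>UNIV. if s k = j then x $ k else 0)"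
  by (simp add: vec_eq_iff matrix_vector_mult_def constituency_matrix_def if_distrib[of "\<lambda>c. c * _"] cong: if_cong)

lemma sum_dhv_class: "sum f (UNIV :: dhv_class set) = f K1 + f K2 + f K3 + f K4 + f K5 + f K6"
  for f :: "dhv_class \<Rightarrow> real"
  by (simp add: UNIV_dhv_class)

lemma all_dhv_class: "(\<forall>k. P k) \<longleftrightarrow> P K1 \<and> P K2 \<and> P K3 \<and> P K4 \<and> P K5 \<and> P K6"
  by (metis dhv_class.exhaust)

lemma dhv_routing_mult_vec:
  "(mat 1 - transpose dhv_routing) *v y =
    (\<chi> k. y $ k - (case k of K1 \<Rightarrow> 0 | K2 \<Rightarrow> y $ K1 | K3 \<Rightarrow> y $ K2 | K4 \<Rightarrow> y $ K3 | K5 \<Rightarrow> y $ K4 | K6 \<Rightarrow> y $ K5))"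
  by (simp add: vec_eq_iff all_dhv_class matrix_vector_mult_def sum_dhv_class mat_def transpose_def dhv_routing_def)

text \<open>The inverse is the lower triangular matrix of ones, because a job in class
  \<open>l\<close> visits each class from \<open>l\<close> on exactly once.\<close>

lemma dhv_throughput:
  "matrix_inv (mat 1 - transpose dhv_routing) *v dhv_arrivals \<alpha>\<^sub>1 = (\<chi> k. \<alpha>\<^sub>1)"
proof -
  define L :: "real ^ dhv_class ^ dhv_class" where "L = (\<chi> k l. if l \<le> k then 1 else 0)"
  have L: "L *v y = (\<chi> k. case k of K1 \<Rightarrow> y $ K1 | K2 \<Rightarrow> y $ K1 + y $ K2 | K3 \<Rightarrow> y $ K1 + y $ K2 + y $ K3
      | K4 \<Rightarrow> y $ K1 + y $ K2 + y $ K3 + y $ K4 | K5 \<Rightarrow> y $ K1 + y $ K2 + y $ K3 + y $ K4 + y $ K5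
      | K6 \<Rightarrow> y $ K1 + y $ K2 + y $ K3 + y $ K4 + y $ K5 + y $ K6)" for y
    by (simp add: L_def vec_eq_iff all_dhv_class matrix_vector_mult_def sum_dhv_class less_eq_dhv_class_def)
  have "(mat 1 - transpose dhv_routing) ** L = mat 1" "L ** (mat 1 - transpose dhv_routing) = mat 1"
    unfolding matrix_eq matrix_vector_mul_assoc[symmetric] L dhv_routing_mult_vec
    by (simp_all add: vec_eq_iff all_dhv_class)
  then have inv: "matrix_inv (mat 1 - transpose dhv_routing) = L" by (rule matrix_inv_eqI)
  show ?thesis unfolding inv L by (simp add: vec_eq_iff all_dhv_class dhv_arrivals_def)
qed

lemma dhv_traffic_intensity_3:
  "dhv_traffic_intensity m \<alpha>\<^sub>1 $ 3 = (m $ K3 + m $ K6) * \<alpha>\<^sub>1"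
  unfolding traffic_intensity_def matrix_vector_mul_assoc[symmetric] dhv_throughput service_matrix_mult_vec
    constituency_matrix_mult_vec
  by (simp add: sum_dhv_class distrib_right)

section \<open>From fluid paths to service rates\<close>

lemma has_vector_derivative_vec:
  fixes f :: "real \<Rightarrow> (real, 'n::finite) vec"
  assumes "\<And>k. ((\<lambda>t. f t $ k) has_real_derivative D k) (at t)"
  shows "(f has_vector_derivative (\<chi> k. D k)) (at t)"
  unfolding has_vector_derivative_def
proof (subst has_derivative_componentwise_within, safe)
  fix i :: "(real, 'n) vec" assume "i \<in> Basis"
  then obtain k where i: "i = axis k 1" by (auto simp: Basis_vec_def)
  show "((\<lambda>x. f x \<bullet> i) has_derivative (\<lambda>x. (x *\<^sub>R (\<chi> k. D k)) \<bullet> i)) (at t)"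
    using assms[of k] by (simp add: i inner_axis has_field_derivative_def mult.commute[of "D k"] mult_commute_abs)
qed

lemma lipschitz_on_vec_nth:
  assumes "L-lipschitz_on S f"
  shows "L-lipschitz_on S (\<lambda>t. f t $ k)"
proof (rule lipschitz_onI)
  fix x y assume "x \<in> S" "y \<in> S"
  have "dist (f x $ k) (f y $ k) \<le> dist (f x) (f y)" by (rule dist_vec_nth_le)
  also have "\<dots> \<le> L * dist x y" by (rule lipschitz_onD[OF assms]) fact+
  finally show "dist (f x $ k) (f y $ k) \<le> L * dist x y" .
qed (rule lipschitz_on_nonneg[OF assms])

text \<open>Near \<open>t\<close> the function \<open>w\<close> stays above \<open>w t / 2\<close>,
  so a vanishing integral gives a neighbourhood of \<open>t\<close> Stieltjes measure 0, and
  \<open>y\<close> is constant there.\<close>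

lemma complementarity_derivative_zero:
  fixes y w :: "real \<Rightarrow> real"
  assumes y: "mono_on {0..} y" "continuous_on {0..} y" and w: "continuous_on {0..} w"
    and int: "(\<integral>\<^sup>+ s\<in>{0..}. ennreal (w s) \<partial>interval_measure (\<lambda>s. y (max 0 s))) = 0"
    and t: "0 < t" "0 < w t" and D: "(y has_real_derivative D) (at t)"
  shows "D = 0"
proof -
  let ?F = "\<lambda>s. y (max 0 s)"
  have "continuous_on {0<..} w" using w by (rule continuous_on_subset) auto
  then have "isCont w t" using t by (simp add: continuous_on_eq_continuous_at)
  then have "\<forall>\<^sub>F s in nhds t. w t / 2 < w s"
    unfolding isCont_def tendsto_at_iff_tendsto_nhds by (rule order_tendstoD) (use t in simp)
  then obtain e where e: "0 < e" "\<And>s. dist s t < e \<Longrightarrow> w t / 2 < w s" unfolding eventually_nhds_metric by blast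
  \<comment> \<open>Keeps the interval inside both the neighbourhood on which \<open>w\<close> is
    large and the half line.\<close>
  define r where "r = min (e / 2) (t / 2)"
  have r: "0 < r" "r < e" "r < t" using e t by (auto simp: r_def)
  have Fmono: "?F a \<le> ?F b" if "a \<le> b" for a b using that by (intro mono_onD[OF y(1)]) auto
  have "continuous_on UNIV ?F"
    by (rule continuous_on_compose2[OF y(2)]) (auto intro!: continuous_intros)
  then have "isCont ?F a" for a by (simp add: continuous_on_eq_continuous_at)
  then have "continuous (at_right a) ?F" for a by (rule continuous_at_imp_continuous_at_within)
  then have m: "emeasure (interval_measure ?F) {t - r<..t + r} = ennreal (?F (t + r) - ?F (t - r))"
    using r by (intro emeasure_interval_measure_Ioc Fmono) auto
  have "ennreal (w t / 2) * emeasure (interval_measure ?F) {t - r<..t + r}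
      = (\<integral>\<^sup>+ s. ennreal (w t / 2) * indicator {t - r<..t + r} s \<partial>interval_measure ?F)"
    by (subst nn_integral_cmult_indicator) auto
  also have "\<dots> \<le> (\<integral>\<^sup>+ s\<in>{0..}. ennreal (w s) \<partial>interval_measure ?F)"
  proof (rule nn_integral_mono)
    fix s
    show "ennreal (w t / 2) * indicator {t - r<..t + r} s \<le> ennreal (w s) * indicator {0..} s"
    proof (cases "s \<in> {t - r<..t + r}")
      case True
      then have "w t / 2 < w s" "0 \<le> s" using e(2)[of s] r by (auto simp: dist_real_def)
      then show ?thesis using True by (simp add: ennreal_leI)
    qed simp
  qed
  finally have "ennreal (?F (t + r) - ?F (t - r)) = 0" using int m t by (simp add: ennreal_eq_0_iff)
  then have le: "y (t + r) \<le> y (t - r)" using r t by (simp add: ennreal_eq_0_iff)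
  have const: "y s = y t" if "\<bar>s - t\<bar> < r" for s
  proof -
    have "y (t - r) \<le> y s" "y s \<le> y (t + r)" "y (t - r) \<le> y t" "y t \<le> y (t + r)"
      using that r by (auto intro!: mono_onD[OF y(1)])
    with le show ?thesis by linarith
  qed
  show ?thesis
  proof (rule DERIV_local_const[OF D r(1)], intro allI impI)
    fix s assume "\<bar>t - s\<bar> < r"
    then have "\<bar>s - t\<bar> < r" by simp
    from const[OF this] show "y t = y s" by simp
  qed
qed

text \<open>The share \<open>p = 1\<close> excludes \<open>0 < x t\<close> and \<open>p = 0\<close>
  excludes \<open>x t < 0\<close>, so a quotient is never 0 merely through division by 0.\<close>

lemma (in station) excess_eq_0_iff:
  assumes "0 \<le> z t" "0 \<le> w t" and x: "x = (\<lambda>t. (1 - p) * \<mu> * z t - p * \<nu> * w t)"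
  shows "surplus p x t = 0 \<longleftrightarrow> x t \<le> 0" "deficit p x t = 0 \<longleftrightarrow> 0 \<le> x t"
proof -
  have "x t \<le> 0" if "p = 1" using that assms pos by simp
  then show "surplus p x t = 0 \<longleftrightarrow> x t \<le> 0" by (auto simp: surplus_def max_def)
  have "0 \<le> x t" if "p = 0" using that assms pos by simp
  then show "deficit p x t = 0 \<longleftrightarrow> 0 \<le> x t" by (auto simp: deficit_def max_def)
qed

lemma has_real_derivative_halfline_cong:
  fixes f g :: "real \<Rightarrow> real"
  assumes "(g has_real_derivative D) (at t)" "0 < t" "\<And>s. 0 \<le> s \<Longrightarrow> f s = g s"
  shows "(f has_real_derivative D) (at t)"
proof -
  have ev: "\<forall>\<^sub>F s in nhds t. s \<in> UNIV \<longrightarrow> f s = g s"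
    using eventually_nhds_in_open[of "{0<..}" t] assms(2,3) by (auto elim: eventually_mono)
  show ?thesis using has_field_derivative_cong_ev[OF refl ev refl refl, of D] assms by simp
qed

lemma dhv_excess_classes:
  "excess_classes dhv_station e K1 = {l \<in> {K1}. 0 < e $ l}"
  "excess_classes dhv_station e K2 = {l \<in> {K2}. 0 < e $ l}"
  "excess_classes dhv_station e K3 = {l \<in> {K3}. 0 < e $ l}"
  "excess_classes dhv_station e K4 = {l \<in> {K1, K4}. 0 < e $ l}"
  "excess_classes dhv_station e K5 = {l \<in> {K2, K5}. 0 < e $ l}"
  "excess_classes dhv_station e K6 = {l \<in> {K3, K6}. 0 < e $ l}"
  unfolding excess_classes_def set_eq_iff all_dhv_class by (simp_all add: less_eq_dhv_class_def)

text \<open>Instantiates \<open>dhv_dynamics\<close>: at almost every time the paths of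
  \<open>T\<close>, the surpluses and the deficits are differentiable, and the fluid equations
  become the flow conditions of the three stations.\<close>

lemma dhv_fluid_collapse:
  fixes m :: "real ^ dhv_class"
  assumes m: "\<And>k. 0 < m $ k" and sums: "m $ K1 + m $ K4 = 1" "m $ K2 + m $ K5 = 1" "m $ K3 + m $ K6 = 1"
    and \<alpha>: "0 \<le> \<alpha>" "\<alpha> \<le> 1"
    and heavy: "m $ K5 * (1 + (m $ K1 / m $ K4 + m $ K2 / m $ K5) * (1 - \<alpha>)) < 1"
      "m $ K6 * (1 + (m $ K1 / m $ K4 + m $ K2 / m $ K5) * (1 - \<alpha>)) < 1"
    and virtual: "m $ K2 + m $ K4 + m $ K6 < 2"
    and ratio: "ratio_matrix dhv_station m \<Delta>"
    and fluid: "fluid_solution dhv_routing dhv_station m (dhv_arrivals \<alpha>) \<Delta> Z W \<epsilon> T Y"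
  shows "\<exists>t\<^sub>0\<ge>0. \<forall>t\<ge>t\<^sub>0. Z t = \<Delta> *v W t"
  using fluid unfolding fluid_solution_def
proof (elim conjE, goal_cases)
  case 1
  note lipZ = 1(1) and lipW = 1(2) and lipT = 1(4) and lipY = 1(5) and Zeq = 1(6)[rule_format]
    and Zpos = 1(7)[rule_format] and Weq = 1(8)[rule_format] and eeq = 1(9)[rule_format]
    and Tmono = 1(11)[rule_format] and Yeq = 1(12)[rule_format] and Ymono = 1(13)[rule_format]
    and int = 1(14)[rule_format] and prio = 1(15)[rule_format]
  have mn: "m $ k \<noteq> 0" for k using m[of k] by simp
  have Z: "Z t $ K1 = Z 0 $ K1 + (t * \<alpha> - T t $ K1 / m $ K1)"
    "Z t $ K2 = Z 0 $ K2 + (T t $ K1 / m $ K1 - T t $ K2 / m $ K2)"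
    "Z t $ K3 = Z 0 $ K3 + (T t $ K2 / m $ K2 - T t $ K3 / m $ K3)"
    "Z t $ K4 = Z 0 $ K4 + (T t $ K3 / m $ K3 - T t $ K4 / m $ K4)"
    "Z t $ K5 = Z 0 $ K5 + (T t $ K4 / m $ K4 - T t $ K5 / m $ K5)"
    "Z t $ K6 = Z 0 $ K6 + (T t $ K5 / m $ K5 - T t $ K6 / m $ K6)" if "0 \<le> t" for t
    by (subst Zeq[OF that]; simp add: matrix_vector_mul_assoc[symmetric] matrix_inv_service_matrix[OF mn]
        service_matrix_mult_vec dhv_routing_mult_vec dhv_arrivals_def)+
  have W: "W t $ 1 = m $ K1 * Z t $ K1 + m $ K4 * Z t $ K4" "W t $ 2 = m $ K2 * Z t $ K2 + m $ K5 * Z t $ K5"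
    "W t $ 3 = m $ K3 * Z t $ K3 + m $ K6 * Z t $ K6" if "0 \<le> t" for t
    by (simp_all add: Weq[OF that] matrix_vector_mul_assoc[symmetric] service_matrix_mult_vec
        constituency_matrix_mult_vec sum_dhv_class)
  have Y: "Y t $ 1 = t - (T t $ K1 + T t $ K4)" "Y t $ 2 = t - (T t $ K2 + T t $ K5)"
    "Y t $ 3 = t - (T t $ K3 + T t $ K6)" if "0 \<le> t" for t
    by (simp_all add: Yeq[OF that] constituency_matrix_mult_vec sum_dhv_class)
  have \<Delta>nn: "0 \<le> \<Delta> $ k $ j" and \<Delta>0: "dhv_station k \<noteq> j \<Longrightarrow> \<Delta> $ k $ j = 0" for k j
    using ratio by (auto simp: ratio_matrix_def)
  have \<Delta>W: "(\<Delta> *v w) $ k = \<Delta> $ k $ dhv_station k * w $ dhv_station k" for w k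
  proof -
    have "(\<Sum>j\<in>UNIV. \<Delta> $ k $ j * w $ j) = (\<Sum>j\<in>{dhv_station k}. \<Delta> $ k $ j * w $ j)"
      by (rule sum.mono_neutral_right) (auto simp: \<Delta>0)
    then show ?thesis by (simp add: matrix_vector_mult_def)
  qed
  have unit: "(constituency_matrix dhv_station ** service_matrix m ** \<Delta>) $ j $ j = 1" for j
    using ratio by (simp add: ratio_matrix_def mat_def)
  have CM: "(constituency_matrix dhv_station ** service_matrix m) $ j $ k = (if dhv_station k = j then m $ k else 0)"
    for j k
    by (cases k) (simp_all add: matrix_matrix_mult_def constituency_matrix_def service_matrix_def sum_dhv_class)
  have ratios: "m $ K1 * \<Delta> $ K1 $ 1 + m $ K4 * \<Delta> $ K4 $ 1 = 1"
    "m $ K2 * \<Delta> $ K2 $ 2 + m $ K5 * \<Delta> $ K5 $ 2 = 1" "m $ K3 * \<Delta> $ K3 $ 3 + m $ K6 * \<Delta> $ K6 $ 3 = 1"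
    using unit[of 1] unit[of 2] unit[of 3]
    unfolding matrix_matrix_mult_def[of "constituency_matrix dhv_station ** service_matrix m"]
    by (simp_all add: CM sum_dhv_class)
  \<comment> \<open>The share of workload assigned to the earlier class. The diagonal of the
    identity for \<open>\<Delta>\<close> leaves \<open>1 - p1\<close> for the later class.\<close>
  define p1 where "p1 = m $ K1 * \<Delta> $ K1 $ 1"
  define p2 where "p2 = m $ K2 * \<Delta> $ K2 $ 2"
  define p3 where "p3 = m $ K3 * \<Delta> $ K3 $ 3"
  have q: "m $ K4 * \<Delta> $ K4 $ 1 = 1 - p1" "m $ K5 * \<Delta> $ K5 $ 2 = 1 - p2" "m $ K6 * \<Delta> $ K6 $ 3 = 1 - p3"
    using ratios by (simp_all add: p1_def p2_def p3_def)
  have pr: "0 \<le> m $ k * \<Delta> $ k $ j" for k j using m[of k] \<Delta>nn[of k j] by simp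
  interpret st1: station "m $ K1" "m $ K4" p1
    using m sums pr[of K1 1] pr[of K4 1] q by unfold_locales (simp_all add: p1_def)
  interpret st2: station "m $ K2" "m $ K5" p2
    using m sums pr[of K2 2] pr[of K5 2] q by unfold_locales (simp_all add: p2_def)
  interpret st3: station "m $ K3" "m $ K6" p3
    using m sums pr[of K3 3] pr[of K6 3] q by unfold_locales (simp_all add: p3_def)
  define x1 where "x1 = (\<lambda>t. (1 - p1) * m $ K1 * Z t $ K1 - p1 * m $ K4 * Z t $ K4)"
  define x2 where "x2 = (\<lambda>t. (1 - p2) * m $ K2 * Z t $ K2 - p2 * m $ K5 * Z t $ K5)"
  define x3 where "x3 = (\<lambda>t. (1 - p3) * m $ K3 * Z t $ K3 - p3 * m $ K6 * Z t $ K6)"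
  \<comment> \<open>The excesses of the two classes of a station, weighted by service times, are
    opposite because \<open>\<Delta>\<close> preserves the workload. One imbalance per station
    therefore encodes both.\<close>
  have scaled: "m $ i * (z - \<Delta> $ i $ r * (m $ i * z + m $ j * w)) = (1 - p) * m $ i * z - p * m $ j * w"
    "m $ j * (w - \<Delta> $ j $ r * (m $ i * z + m $ j * w)) = - ((1 - p) * m $ i * z - p * m $ j * w)"
    if "m $ i * \<Delta> $ i $ r = p" "m $ j * \<Delta> $ j $ r = 1 - p" for i j r z w p
  proof -
    have "m $ i * (z - \<Delta> $ i $ r * (m $ i * z + m $ j * w)) =
        m $ i * z - m $ i * \<Delta> $ i $ r * (m $ i * z + m $ j * w)" by (simp add: algebra_simps)
    also have "\<dots> = (1 - p) * m $ i * z - p * m $ j * w" unfolding that(1) by (simp add: algebra_simps)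
    finally show "m $ i * (z - \<Delta> $ i $ r * (m $ i * z + m $ j * w)) = (1 - p) * m $ i * z - p * m $ j * w" .
    have "m $ j * (w - \<Delta> $ j $ r * (m $ i * z + m $ j * w)) =
        m $ j * w - m $ j * \<Delta> $ j $ r * (m $ i * z + m $ j * w)" by (simp add: algebra_simps)
    also have "\<dots> = - ((1 - p) * m $ i * z - p * m $ j * w)" unfolding that(2) by (simp add: algebra_simps)
    finally show "m $ j * (w - \<Delta> $ j $ r * (m $ i * z + m $ j * w)) = - ((1 - p) * m $ i * z - p * m $ j * w)" .
  qed
  have ex: "m $ K1 * \<epsilon> t $ K1 = x1 t" "m $ K4 * \<epsilon> t $ K4 = - x1 t" "m $ K2 * \<epsilon> t $ K2 = x2 t"
    "m $ K5 * \<epsilon> t $ K5 = - x2 t" "m $ K3 * \<epsilon> t $ K3 = x3 t" "m $ K6 * \<epsilon> t $ K6 = - x3 t" if "0 \<le> t" for t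
    unfolding x1_def x2_def x3_def eeq[OF that] vector_minus_component \<Delta>W dhv_station.simps W[OF that]
    by (rule scaled[OF p1_def[symmetric] q(1)] scaled[OF p2_def[symmetric] q(2)] scaled[OF p3_def[symmetric] q(3)])+
  have lipx: "\<exists>L. L-lipschitz_on {0..} (\<lambda>t. a * Z t $ i - b * Z t $ j)" for a b i j
  proof -
    obtain L where "L-lipschitz_on {0..} Z" using lipZ by blast
    then have "(\<bar>a\<bar> * L + \<bar>b\<bar> * L)-lipschitz_on {0..} (\<lambda>t. a * Z t $ i - b * Z t $ j)"
      by (intro lipschitz_on_diff lipschitz_on_cmult_real lipschitz_on_vec_nth)
    then show ?thesis by blast
  qed
  have lip: "\<exists>L. L-lipschitz_on {0..} x1" "\<exists>L. L-lipschitz_on {0..} x2" "\<exists>L. L-lipschitz_on {0..} x3"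
    unfolding x1_def x2_def x3_def by (rule lipx)+
  have Tdiff: "AE t in lborel. 0 < t \<longrightarrow> (\<exists>D. ((\<lambda>t. T t $ k) has_real_derivative D) (at t))" for k
    using lipT lipschitz_on_vec_nth lipschitz_halfline_AE_differentiable by blast
  have surplus_diff: "AE t in lborel. 0 < t \<longrightarrow> (\<exists>D. (surplus p x has_real_derivative D) (at t))"
    if "\<exists>L. L-lipschitz_on {0..} x" for p x
    using lipschitz_surplus[OF that] lipschitz_halfline_AE_differentiable by blast
  have deficit_diff: "AE t in lborel. 0 < t \<longrightarrow> (\<exists>D. (deficit p x has_real_derivative D) (at t))"
    if "\<exists>L. L-lipschitz_on {0..} x" for p x
    using lipschitz_deficit[OF that] lipschitz_halfline_AE_differentiable by blast
  have cont: "continuous_on {0..} (\<lambda>t. W t $ j)" "continuous_on {0..} (\<lambda>t. Y t $ j)" for j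
    using lipW lipY lipschitz_on_vec_nth lipschitz_on_continuous_on by blast+
  have rates: "AE t in lborel. 0 < t \<longrightarrow> (\<exists>d1 d2 d3 d4 d5 d6.
      station_flow (m $ K1) (m $ K4) p1 \<alpha> d3 (x1 t) d1 d4 \<and> station_drift (m $ K1) (m $ K4) p1 \<alpha> d3 x1 t \<and>
      station_flow (m $ K2) (m $ K5) p2 d1 d4 (x2 t) d2 d5 \<and> station_drift (m $ K2) (m $ K5) p2 d1 d4 x2 t \<and>
      station_flow (m $ K3) (m $ K6) p3 d2 d5 (x3 t) d3 d6 \<and> station_drift (m $ K3) (m $ K6) p3 d2 d5 x3 t)"
    using Tdiff[of K1] Tdiff[of K2] Tdiff[of K3] Tdiff[of K4] Tdiff[of K5] Tdiff[of K6]
      surplus_diff[OF lip(1), of p1] surplus_diff[OF lip(2), of p2] surplus_diff[OF lip(3), of p3]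
      deficit_diff[OF lip(1), of p1] deficit_diff[OF lip(2), of p2] deficit_diff[OF lip(3), of p3]
  proof eventually_elim
    case (elim t)
    show ?case
    proof
      assume t: "0 < t"
      then have "\<exists>D. ((\<lambda>t. T t $ k) has_real_derivative D) (at t)" for k using elim(1-6) by (cases k) auto
      then obtain u where u: "\<And>k. ((\<lambda>t. T t $ k) has_real_derivative u k) (at t)" by metis
      then have T': "(T has_vector_derivative (\<chi> k. u k)) (at t)" by (rule has_vector_derivative_vec)
      have un: "0 \<le> u k" for k
        using mono_on_imp_deriv_nonneg[OF Tmono[of k] u[of k]] t by (simp add: interior_real_atLeast)
      \<comment> \<open>\<open>u k\<close> is the fraction of time spent on class \<open>k\<close>;
        division by the mean service time gives the departure rate.\<close>
      define d where "d k = u k / m $ k" for k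
      have md: "m $ k * d k = u k" for k using mn[of k] by (simp add: d_def)
      have dn: "0 \<le> d k" for k using un[of k] m[of k] by (simp add: d_def)
      have Td: "((\<lambda>t. T t $ k / m $ k) has_real_derivative d k) (at t)" for k
        unfolding d_def by (rule DERIV_cdivide[OF u])
      have Zd: "((\<lambda>s. Z s $ K1) has_real_derivative \<alpha> - d K1) (at t)"
        "((\<lambda>s. Z s $ K2) has_real_derivative d K1 - d K2) (at t)"
        "((\<lambda>s. Z s $ K3) has_real_derivative d K2 - d K3) (at t)"
        "((\<lambda>s. Z s $ K4) has_real_derivative d K3 - d K4) (at t)"
        "((\<lambda>s. Z s $ K5) has_real_derivative d K4 - d K5) (at t)"
        "((\<lambda>s. Z s $ K6) has_real_derivative d K5 - d K6) (at t)"
      proof -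
        have in_out: "((\<lambda>s. c + (T s $ k / m $ k - T s $ l / m $ l)) has_real_derivative d k - d l) (at t)" for c k l
          using DERIV_add[OF DERIV_const DERIV_diff[OF Td[of k] Td[of l]], of c] by simp
        have arr: "((\<lambda>s. c + (s * \<alpha> - T s $ l / m $ l)) has_real_derivative \<alpha> - d l) (at t)" for c l
          using DERIV_add[OF DERIV_const DERIV_diff[OF DERIV_cmult_right[OF DERIV_ident] Td[of l]], of c] by simp
        show "((\<lambda>s. Z s $ K1) has_real_derivative \<alpha> - d K1) (at t)"
          by (rule has_real_derivative_halfline_cong[OF arr t Z(1)])
        show "((\<lambda>s. Z s $ K2) has_real_derivative d K1 - d K2) (at t)"
          by (rule has_real_derivative_halfline_cong[OF in_out t Z(2)])
        show "((\<lambda>s. Z s $ K3) has_real_derivative d K2 - d K3) (at t)"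
          by (rule has_real_derivative_halfline_cong[OF in_out t Z(3)])
        show "((\<lambda>s. Z s $ K4) has_real_derivative d K3 - d K4) (at t)"
          by (rule has_real_derivative_halfline_cong[OF in_out t Z(4)])
        show "((\<lambda>s. Z s $ K5) has_real_derivative d K4 - d K5) (at t)"
          by (rule has_real_derivative_halfline_cong[OF in_out t Z(5)])
        show "((\<lambda>s. Z s $ K6) has_real_derivative d K5 - d K6) (at t)"
          by (rule has_real_derivative_halfline_cong[OF in_out t Z(6)])
      qed
      have Yd: "((\<lambda>s. Y s $ r) has_real_derivative 1 - (u i + u j)) (at t)"
        if "\<And>s. 0 \<le> s \<Longrightarrow> Y s $ r = s - (T s $ i + T s $ j)" for i j r
        by (rule has_real_derivative_halfline_cong[OF DERIV_diff[OF DERIV_ident DERIV_add[OF u u]] t that])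
      \<comment> \<open>One argument for the three stations: \<open>i\<close> is the earlier class,
        \<open>j\<close> the later one, and \<open>a\<close>, \<open>b\<close> are their arrival
        rates.\<close>
      have at: "station_flow (m $ i) (m $ j) p a b (x t) (d i) (d j) \<and> station_drift (m $ i) (m $ j) p a b x t"
        if st: "station (m $ i) (m $ j) p" and x: "x = (\<lambda>t. (1 - p) * m $ i * Z t $ i - p * m $ j * Z t $ j)"
          and Zi: "((\<lambda>s. Z s $ i) has_real_derivative a - d i) (at t)"
          and Zj: "((\<lambda>s. Z s $ j) has_real_derivative b - d j) (at t)"
          and ab: "0 \<le> a" "0 \<le> b"
          and ex: "m $ i * \<epsilon> t $ i = x t" "m $ j * \<epsilon> t $ j = - x t"
          and E: "excess_classes dhv_station (\<epsilon> t) i = {l \<in> {i}. 0 < \<epsilon> t $ l}"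
            "excess_classes dhv_station (\<epsilon> t) j = {l \<in> {i, j}. 0 < \<epsilon> t $ l}"
          and Wr: "W t $ r = m $ i * Z t $ i + m $ j * Z t $ j"
          and Yr: "\<And>s. 0 \<le> s \<Longrightarrow> Y s $ r = s - (T s $ i + T s $ j)"
          and diff: "0 < t \<longrightarrow> (\<exists>D. (surplus p x has_real_derivative D) (at t))"
            "0 < t \<longrightarrow> (\<exists>D. (deficit p x has_real_derivative D) (at t))"
        for i j p a b x r
      proof -
        have sgn: "0 < \<epsilon> t $ i \<longleftrightarrow> 0 < x t" "0 < \<epsilon> t $ j \<longleftrightarrow> x t < 0"
          using ex m[of i] m[of j]
          by (metis zero_less_mult_iff less_not_sym, metis neg_0_less_iff_less zero_less_mult_iff less_not_sym)
        have cap: "u i + u j \<le> 1"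
          using mono_on_imp_deriv_nonneg[OF Ymono[of r] Yd[OF Yr]] t by (simp add: interior_real_atLeast)
        have hi: "u i = 1 \<and> u j = 0" if "0 < x t"
        proof -
          have "excess_classes dhv_station (\<epsilon> t) i = {i}" "0 < \<epsilon> t $ i" using E(1) sgn that by auto
          then have "u i = 1" using prio[OF t T', of i] by simp
          then show ?thesis using cap un[of j] by simp
        qed
        \<comment> \<open>For \<open>x t < 0\<close> the earlier class has no excess, so the
          priority condition at \<open>j\<close> involves \<open>j\<close> alone and gives
          \<open>u j = 1\<close>; capacity then leaves nothing for \<open>i\<close>.\<close>
        have lo: "u i = 0 \<and> u j = 1" if "x t < 0"
        proof -
          have "excess_classes dhv_station (\<epsilon> t) j = {j}" "0 < \<epsilon> t $ j" using E(2) sgn that by auto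
          then have "u j = 1" using prio[OF t T', of j] by simp
          then show ?thesis using cap un[of i] by simp
        qed
        have work: "u i + u j = 1" if "0 < W t $ r"
          using complementarity_derivative_zero[OF Ymono cont(2) cont(1) int t that Yd[OF Yr]] by simp
        have "m $ i * d i = 1 \<and> d j = 0" if "0 < x t" using hi[OF that] by (simp add: md d_def[of j])
        moreover have "d i = 0 \<and> m $ j * d j = 1" if "x t < 0" using lo[OF that] by (simp add: md d_def[of i])
        ultimately show ?thesis
          using Zpos ab dn cap work diff t
          by (intro station.station_at[OF st x t Zi _ Zj]) (auto simp: md Wr)
      qed
      have t': "0 \<le> t" using t by simp
      show "\<exists>d1 d2 d3 d4 d5 d6.
        station_flow (m $ K1) (m $ K4) p1 \<alpha> d3 (x1 t) d1 d4 \<and> station_drift (m $ K1) (m $ K4) p1 \<alpha> d3 x1 t \<and>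
        station_flow (m $ K2) (m $ K5) p2 d1 d4 (x2 t) d2 d5 \<and> station_drift (m $ K2) (m $ K5) p2 d1 d4 x2 t \<and>
        station_flow (m $ K3) (m $ K6) p3 d2 d5 (x3 t) d3 d6 \<and> station_drift (m $ K3) (m $ K6) p3 d2 d5 x3 t"
        using at[OF st1.station_axioms x1_def Zd(1) Zd(4) \<alpha>(1) dn ex(1,2)[OF t'] dhv_excess_classes(1,4) W(1)[OF t']
            Y(1) elim(7,10)]
          at[OF st2.station_axioms x2_def Zd(2) Zd(5) dn dn ex(3,4)[OF t'] dhv_excess_classes(2,5) W(2)[OF t']
            Y(2) elim(8,11)]
          at[OF st3.station_axioms x3_def Zd(3) Zd(6) dn dn ex(5,6)[OF t'] dhv_excess_classes(3,6) W(3)[OF t']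
            Y(3) elim(9,12)]
        by blast
    qed
  qed
  have sgn: "surplus p1 x1 t = 0 \<longleftrightarrow> x1 t \<le> 0" "deficit p1 x1 t = 0 \<longleftrightarrow> 0 \<le> x1 t"
    "surplus p2 x2 t = 0 \<longleftrightarrow> x2 t \<le> 0" "deficit p2 x2 t = 0 \<longleftrightarrow> 0 \<le> x2 t"
    "surplus p3 x3 t = 0 \<longleftrightarrow> x3 t \<le> 0" "deficit p3 x3 t = 0 \<longleftrightarrow> 0 \<le> x3 t" if "0 \<le> t" for t
    by (rule st1.excess_eq_0_iff[OF _ _ x1_def] st2.excess_eq_0_iff[OF _ _ x2_def] st3.excess_eq_0_iff[OF _ _ x3_def];
        rule Zpos[OF that])+
  interpret dhv_dynamics "m $ K1" "m $ K2" "m $ K3" "m $ K4" "m $ K5" "m $ K6" p1 p2 p3 \<alpha> x1 x2 x3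
    by unfold_locales (assumption | rule \<alpha> heavy lip sgn rates)+
  obtain t1 where t1: "0 \<le> t1" and x0: "\<And>t. t1 \<le> t \<Longrightarrow> x1 t = 0 \<and> x2 t = 0 \<and> x3 t = 0"
    using collapse[OF virtual] by blast
  have "Z t = \<Delta> *v W t" if "t1 \<le> t" for t
  proof -
    have t: "0 \<le> t" using that t1 by simp
    have "\<epsilon> t $ k = 0" for k using ex[OF t] x0[OF that] mn by (cases k) auto
    then have "\<epsilon> t = 0" by (simp add: vec_eq_iff)
    then show ?thesis using eeq[OF t] by simp
  qed
  then show ?case using t1 by blast
qed

theorem corollary4:
  fixes m :: "real ^ dhv_class"
  assumes "\<And>k. 0 < m $ k"
    and "m $ K1 + m $ K4 = 1" and "m $ K2 + m $ K5 = 1" and "m $ K3 + m $ K6 = 1"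
  shows "\<exists>\<alpha>bar::real. 0 < \<alpha>bar \<and> \<alpha>bar < 1 \<and>
    (\<forall>\<alpha>\<^sub>1::real. \<alpha>bar < \<alpha>\<^sub>1 \<longrightarrow>
      dhv_traffic_intensity m \<alpha>\<^sub>1 $ 1 = dhv_traffic_intensity m \<alpha>\<^sub>1 $ 2 \<longrightarrow>
      dhv_traffic_intensity m \<alpha>\<^sub>1 $ 2 = dhv_traffic_intensity m \<alpha>\<^sub>1 $ 3 \<longrightarrow>
      dhv_traffic_intensity m \<alpha>\<^sub>1 $ 3 < 1 \<longrightarrow>
      m $ K2 + m $ K4 + m $ K6 < 2 \<longrightarrow>
      (\<forall>\<Delta>. ratio_matrix dhv_station m \<Delta> \<longrightarrow>
        state_space_collapse dhv_routing dhv_station m (dhv_arrivals \<alpha>\<^sub>1) \<Delta>))"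
proof -
  define \<kappa> where "\<kappa> = m $ K1 / m $ K4 + m $ K2 / m $ K5"
  \<comment> \<open>The two quotients are the values of \<open>1 - \<alpha>\<close> at which the
    \<open>heavy\<close> inequalities become equalities. The bound \<open>1 / 2\<close> keeps
    \<open>1 - \<delta>\<close> positive. Only \<open>m\<close> enters, so the threshold serves
    every \<open>\<Delta>\<close>.\<close>
  define \<delta> where "\<delta> = min (1 / 2) (min (m $ K2 / (m $ K5 * \<kappa>)) (m $ K3 / (m $ K6 * \<kappa>)))"
  have \<kappa>: "0 < \<kappa>" using assms(1) by (simp add: \<kappa>_def add_pos_pos)
  have \<delta>: "0 < \<delta>" "\<delta> < 1" using assms(1) \<kappa> by (simp_all add: \<delta>_def min_less_iff_disj)
  have slack: "m $ K5 * (1 + \<kappa> * (1 - \<alpha>)) < 1" "m $ K6 * (1 + \<kappa> * (1 - \<alpha>)) < 1" if "1 - \<delta> < \<alpha>" for \<alpha>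
  proof -
    have pos: "0 < m $ K5 * \<kappa>" "0 < m $ K6 * \<kappa>" using assms(1) \<kappa> by simp_all
    have "1 - \<alpha> < m $ K2 / (m $ K5 * \<kappa>)" "1 - \<alpha> < m $ K3 / (m $ K6 * \<kappa>)"
      using that unfolding \<delta>_def by linarith+
    then have "(1 - \<alpha>) * (m $ K5 * \<kappa>) < m $ K2" "(1 - \<alpha>) * (m $ K6 * \<kappa>) < m $ K3"
      using pos by (simp_all only: pos_less_divide_eq)
    then show "m $ K5 * (1 + \<kappa> * (1 - \<alpha>)) < 1" "m $ K6 * (1 + \<kappa> * (1 - \<alpha>)) < 1"
      using assms(3,4) by (simp_all add: algebra_simps)
  qed
  show ?thesis
  proof (intro exI[of _ "1 - \<delta>"] conjI allI impI)
    fix \<alpha>\<^sub>1 :: real and \<Delta>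
    assume \<alpha>: "1 - \<delta> < \<alpha>\<^sub>1" and load: "dhv_traffic_intensity m \<alpha>\<^sub>1 $ 3 < 1"
      and virtual: "m $ K2 + m $ K4 + m $ K6 < 2" and ratio: "ratio_matrix dhv_station m \<Delta>"
    \<comment> \<open>Since \<open>m $ K3 + m $ K6 = 1\<close>, the load of station 3 is
      \<open>\<alpha>\<^sub>1\<close> itself.\<close>
    have "0 \<le> \<alpha>\<^sub>1" "\<alpha>\<^sub>1 \<le> 1" using \<alpha> \<delta> load assms(4) by (simp_all add: dhv_traffic_intensity_3)
    then show "state_space_collapse dhv_routing dhv_station m (dhv_arrivals \<alpha>\<^sub>1) \<Delta>"
      unfolding state_space_collapse_def
      using dhv_fluid_collapse[OF assms _ _ _ _ virtual ratio] slack[OF \<alpha>] unfolding \<kappa>_def by blast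
  qed (use \<delta> in simp_all)
qed

end
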